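(* Let $(U,V)$ be a bivariate normal random vector with zero mean vector, variances $(\sigma_U^2,\sigma_V^2)$ with $\sigma_U,\sigma_V>0$, and correlation coefficient $\rho\in(-1,1)$. Let $Z=UV$ and $s=\sigma_U\sigma_V$. Let $n\ge1$ be an integer, let $Z_1,\ldots,Z_n$ be independent copies of $Z$, let $\overline{Z}_n=n^{-1}(Z_1+\cdots+Z_n)$, and let $F_{\overline{Z}_n}(x)=\mathbb{P}(\overline{Z}_n\le x)$. Then: (i) for $x\ge0$, $$F_{\overline{Z}_n}(x)=1-\frac{(1-\rho^2)^{n/2}}{2\sqrt{\pi}\,\Gamma(n/2)}\sum_{k=0}^\infty\frac{(2\rho)^k}{k!}\Gamma\Big(\frac{k+1}{2}\Big)\Gamma\Big(\frac{n+k}{2}\Big)\tilde G_{\frac{n-1}{2}+k,\frac{n-1}{2}}\Big(\frac{nx}{s(1-\rho^2)}\Big);$$ (ii) for $x<0$, $$F_{\overline{Z}_n}(x)=\frac{(1-\rho^2)^{n/2}}{2\sqrt{\pi}\,\Gamma(n/2)}\sum_{k=0}^\infty\frac{(-2\rho)^k}{k!}\Gamma\Big(\frac{k+1}{2}\Big)\Gamma\Big(\frac{n+k}{2}\Big)\tilde G_{\frac{n-1}{2}+k,\frac{n-1}{2}}\Big(-\frac{nx}{s(1-\rho^2)}\Big);$$ (iii) for all $x\in\mathbb{R}$, $$F_{\overline{Z}_n}(x)=\frac12-\frac{\Gamma((n+1)/2)}{\sqrt{\pi}\,\Gamma(n/2)}\rho(1-\rho^2)^{n/2}{}_2F_1\Big(1,\frac{n+1}{2};\frac32;\rho^2\Big)$$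 $$\qquad+\frac{(1-\rho^2)^{n/2}}{2\sqrt{\pi}\,\Gamma(n/2)}\sum_{k=0}^\infty(\mathrm{sgn}(x))^{k+1}\frac{(2\rho)^k}{k!}\Gamma\Big(\frac{k+1}{2}\Big)\Gamma\Big(\frac{n+k}{2}\Big)G_{\frac{n-1}{2}+k,\frac{n-1}{2}}\Big(\frac{n|x|}{s(1-\rho^2)}\Big).$$ In particular, $$\mathbb{P}(\overline{Z}_n\le0)=\frac12-\frac{\Gamma((n+1)/2)}{\sqrt{\pi}\,\Gamma(n/2)}\rho(1-\rho^2)^{n/2}{}_2F_1\Big(1,\frac{n+1}{2};\frac32;\rho^2\Big).$$
   Context: Modified Bessel function of the second kind: for $\nu\in\mathbb{R}$ and $x>0$, $K_\nu(x)=\int_0^\infty \mathrm{e}^{-x\cosh t}\cosh(\nu t)\,\mathrm{d}t$. Normalised modified Lommel function of the first kind: for $x>0$, $$\tilde t_{\lambda,\nu}(x)=\sum_{k=0}^\infty\frac{(x/2)^{\lambda+2k+1}}{\Gamma\big(k+\frac{\lambda-\nu+3}{2}\big)\Gamma\big(k+\frac{\lambda+\nu+3}{2}\big)}.$$ For $\lambda\ge\nu>-1/2$ and $x>0$, $$G_{\lambda,\nu}(x)=x\big(K_\nu(x)\tilde t_{\lambda-1,\nu-1}(x)+K_{\nu-1}(x)\tilde t_{\lambda,\nu}(x)\big),\qquad \tilde G_{\lambda,\nu}(x)=1-G_{\lambda,\nu}(x).$$ At $x=0$ these are understood as limits as $x\downarrow0$, i.e. $G_{\lambda,\nu}(0)=0$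 and $\tilde G_{\lambda,\nu}(0)=1$. Gaussian hypergeometric function: ${}_2F_1(a,b;c;x)=\sum_{j=0}^\infty\frac{(a)_j(b)_j}{(c)_j}\frac{x^j}{j!}$ for $|x|<1$, where $(u)_j=u(u+1)\cdots(u+j-1)$, $(u)_0=1$. $\mathrm{sgn}(x)=1$ for $x>0$, $\mathrm{sgn}(0)=0$, $\mathrm{sgn}(x)=-1$ for $x<0$. The convention $0^0=1$ is used for $(\pm2\rho)^0$. *)

theory Defs
  imports "HOL-Probability.Probability"
begin

text \<open>Centred, non-degenerate bivariate normal law with standard deviations
  \<open>\<sigma>\<^sub>1\<close>, \<open>\<sigma>\<^sub>2\<close> and correlation coefficient \<open>\<rho>\<close>, given by its Lebesgue density
  (meaningful for \<open>\<sigma>\<^sub>1, \<sigma>\<^sub>2 > 0\<close> and \<open>\<bar>\<rho>\<bar> < 1\<close>).\<close>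

definition bivariate_normal_density :: "real \<Rightarrow> real \<Rightarrow> real \<Rightarrow> real \<Rightarrow> real \<Rightarrow> real" where
  "bivariate_normal_density \<sigma>\<^sub>1 \<sigma>\<^sub>2 \<rho> u v =
     1 / (2 * pi * \<sigma>\<^sub>1 * \<sigma>\<^sub>2 * sqrt (1 - \<rho>\<^sup>2)) *
     exp (- (1 / (2 * (1 - \<rho>\<^sup>2))) *
            (u\<^sup>2 / \<sigma>\<^sub>1\<^sup>2 - 2 * \<rho> * u * v / (\<sigma>\<^sub>1 * \<sigma>\<^sub>2) + v\<^sup>2 / \<sigma>\<^sub>2\<^sup>2))"

definition centred_bivariate_normal ::
  "'a measure \<Rightarrow> ('a \<Rightarrow> real) \<Rightarrow> ('a \<Rightarrow> real) \<Rightarrow> real \<Rightarrow> real \<Rightarrow> real \<Rightarrow> bool" where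
  "centred_bivariate_normal M U V \<sigma>\<^sub>1 \<sigma>\<^sub>2 \<rho> \<longleftrightarrow>
     distributed M (lborel \<Otimes>\<^sub>M lborel) (\<lambda>\<omega>. (U \<omega>, V \<omega>))
       (\<lambda>(u, v). ennreal (bivariate_normal_density \<sigma>\<^sub>1 \<sigma>\<^sub>2 \<rho> u v))"

definition bessel_K :: "real \<Rightarrow> real \<Rightarrow> real" where
  "bessel_K \<nu> x = (LBINT t:{0..}. exp (- x * cosh t) * cosh (\<nu> * t))"

text \<open>Normalised modified Lommel function of the first kind; \<open>\<mu>\<close> is the index usually written
  \<open>\<lambda>\<close>, which is reserved syntax here.\<close>

definition lommel_t :: "real \<Rightarrow> real \<Rightarrow> real \<Rightarrow> real" where
  "lommel_t \<mu> \<nu> x =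
     (\<Sum>k. (x / 2) powr (\<mu> + 2 * real k + 1) /
          (Gamma (real k + (\<mu> - \<nu> + 3) / 2) * Gamma (real k + (\<mu> + \<nu> + 3) / 2)))"

text \<open>The value at \<open>0\<close> is the limit as \<open>x \<down> 0\<close> (for \<open>\<mu> \<ge> \<nu> > -1/2\<close>); it has to be fixed
  separately because \<open>bessel_K \<nu> 0\<close> has no meaning. Negative arguments are never used.\<close>

definition lommel_G :: "real \<Rightarrow> real \<Rightarrow> real \<Rightarrow> real" where
  "lommel_G \<mu> \<nu> x =
     (if x = 0 then 0
      else x * (bessel_K \<nu> x * lommel_t (\<mu> - 1) (\<nu> - 1) x +
                bessel_K (\<nu> - 1) x * lommel_t \<mu> \<nu> x))"

definition lommel_G_tilde :: "real \<Rightarrow> real \<Rightarrow> real \<Rightarrow> real" where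
  "lommel_G_tilde \<mu> \<nu> x = 1 - lommel_G \<mu> \<nu> x"

definition hypergeo_2F1 :: "real \<Rightarrow> real \<Rightarrow> real \<Rightarrow> real \<Rightarrow> real" where
  "hypergeo_2F1 a b c x =
     (\<Sum>j. pochhammer a j * pochhammer b j / pochhammer c j * (x ^ j / fact j))"

definition sample_mean :: "nat \<Rightarrow> (nat \<Rightarrow> 'b \<Rightarrow> real) \<Rightarrow> 'b \<Rightarrow> real" where
  "sample_mean n Z \<omega> = (\<Sum>i = 1..n. Z i \<omega>) / real n"

end

theory Submission
  imports Defs
begin

text \<open>
  Write \<open>r = 1 - \<rho>\<^sup>2\<close>, \<open>c = s r\<close> and \<open>\<nu> = (n - 1) / 2\<close>. The idea is that the rescaled sum
  \<open>Y = (Z\<^sub>1 + \<dots> + Z\<^sub>n) / c\<close> has the variance-gamma density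
  \<open>C 2 powr (1 - \<nu>) exp (\<rho> y) \<bar>y\<bar> powr \<nu> K\<^sub>\<nu>(\<bar>y\<bar>)\<close>, where
  \<open>C = r powr (n / 2) / (2 sqrt \<pi> \<Gamma>(n / 2))\<close>. Expanding \<open>exp (\<rho> y)\<close> in a power series reduces
  the distribution function to the tail integrals of \<open>y powr (\<nu> + k) K\<^sub>\<nu>(y)\<close>, and these are
  exactly what the functions \<open>G\<close> describe.

  Integrating the bivariate normal density along the hyperbolas \<open>u v = c y\<close> shows
  that \<open>U V / c\<close> has density \<open>sqrt r exp (\<rho> y) h(1/2, y)\<close>
  (\<open>distributed_product_centred_bivariate_normal\<close>), where \<open>h(\<alpha>, \<cdot>)\<close> is a centred normal density
  whose variance is twice a gamma variable of shape \<open>\<alpha>\<close>. Variances of independent normal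
  variables add and shapes of independent gamma variables add, so \<open>h(\<alpha>, \<cdot>) * h(\<beta>, \<cdot>) = h(\<alpha> + \<beta>, \<cdot>)\<close>
  (\<open>variance_gamma_density_convolution\<close>); the tilt \<open>exp (\<rho> y)\<close> is multiplicative and passes through
  convolutions unchanged. The mixing integral in \<open>h(n/2, \<cdot>)\<close> is an integral representation of
  \<open>K\<^sub>\<nu>\<close> (\<open>bessel_K_integral_representation\<close>).

  The Wronskian-like combination \<open>G\<close> of Bessel and Lommel functions is an
  antiderivative: the first-order recurrences of both families make all terms of the product rule
  cancel except \<open>x powr \<mu> K\<^sub>\<nu>(x) / m\<close> with
  \<open>m = 2 powr (\<mu> - 1) \<Gamma>((\<mu> - \<nu> + 1) / 2) \<Gamma>((\<mu> + \<nu> + 1) / 2)\<close> (\<open>DERIV_lommel_G\<close>). As \<open>G\<close> vanishes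
  at \<open>0\<close> and \<open>m\<close> is the whole Mellin integral, the tail integral is \<open>m (1 - G)\<close>
  (\<open>integral_powr_bessel_K_tail\<close>). The recurrence and the Mellin transform of \<open>K\<close> both come
  from applying Tonelli's theorem to the integral representation.

  Termwise integration (\<open>exp_powr_bessel_K_tail_sums\<close>) gives the expansions for
  \<open>x \<ge> 0\<close> and, after the reflection \<open>y \<mapsto> -y\<close>, for \<open>x < 0\<close>. Comparing the two expansions at \<open>0\<close>
  gives \<open>P(Y > 0) - P(Y \<le> 0)\<close> as twice the odd part of the series, which is the hypergeometric
  series (\<open>lommel_tail_term_odd_sums\<close>); since the two probabilities add up to \<open>1\<close>, this determines
  \<open>P(Y \<le> 0)\<close>, and subtracting the expansion at \<open>0\<close> from the one at \<open>x\<close> turns \<open>1 - G\<close> into \<open>G\<close>.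
\<close>

section \<open>Integration over the real line\<close>

text \<open>
  The change-of-variables theorem for absolutely integrable functions determines when either side
  equals a given real number. It extends to extended nonnegative integrals because the two sides
  take the same finite values, so they are infinite together.
\<close>

lemma set_nn_integral_change_of_variables:
  fixes f g g' :: "real \<Rightarrow> real"
  assumes [measurable]: "S \<in> sets borel" "T \<in> sets borel"
    "f \<in> borel_measurable borel" "g \<in> borel_measurable borel" "g' \<in> borel_measurable borel"
    and deriv: "\<And>x. x \<in> S \<Longrightarrow> (g has_real_derivative g' x) (at x)"
    and inj: "inj_on g S" and im: "g ` S = T"
    and nonneg: "\<And>y. 0 \<le> f y"
  shows "(\<integral>\<^sup>+y\<in>T. ennreal (f y) \<partial>lborel) = (\<integral>\<^sup>+x\<in>S. ennreal (\<bar>g' x\<bar> * f (g x)) \<partial>lborel)"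
proof -
  have fin_iff: "((\<integral>\<^sup>+x\<in>A. ennreal (F x) \<partial>lborel) = ennreal b) \<longleftrightarrow>
      F absolutely_integrable_on A \<and> integral A F = b"
    if [measurable]: "A \<in> sets borel" "F \<in> borel_measurable borel" and F: "\<And>x. 0 \<le> F x" and b: "0 \<le> b"
    for A F and b :: real
  proof -
    have eq: "(\<integral>\<^sup>+x\<in>A. ennreal (F x) \<partial>lborel) = (\<integral>\<^sup>+x. ennreal (indicator A x * F x) \<partial>lborel)"
      by (intro nn_integral_cong) (auto simp: indicator_def)
    have "((\<integral>\<^sup>+x\<in>A. ennreal (F x) \<partial>lborel) = ennreal b) \<longleftrightarrow> (F has_integral b) A"
    proof
      assume "(\<integral>\<^sup>+x\<in>A. ennreal (F x) \<partial>lborel) = ennreal b"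
      then have "((\<lambda>x. indicator A x * F x) has_integral b) UNIV"
        using F b unfolding eq by (intro nn_integral_has_integral) auto
      then show "(F has_integral b) A"
        unfolding has_integral_restrict_UNIV[of A F, symmetric]
        by (rule has_integral_eq[rotated]) (simp add: indicator_def)
    next
      assume "(F has_integral b) A"
      then show "(\<integral>\<^sup>+x\<in>A. ennreal (F x) \<partial>lborel) = ennreal b"
        using nn_integral_has_integral_lebesgue[of A F b] F unfolding eq by simp
    qed
    also have "\<dots> \<longleftrightarrow> F absolutely_integrable_on A \<and> integral A F = b"
      using F by (auto simp: has_integral_iff absolutely_integrable_on_def)
    finally show ?thesis .
  qed
  let ?L = "\<integral>\<^sup>+y\<in>T. ennreal (f y) \<partial>lborel"
  let ?R = "\<integral>\<^sup>+x\<in>S. ennreal (\<bar>g' x\<bar> * f (g x)) \<partial>lborel"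
  have iff: "?L = ennreal b \<longleftrightarrow> ?R = ennreal b" if "0 \<le> b" for b
  proof -
    have "S \<in> sets lebesgue" by simp
    then have "(\<lambda>x. \<bar>g' x\<bar> * f (g x)) absolutely_integrable_on S \<and> integral S (\<lambda>x. \<bar>g' x\<bar> * f (g x)) = b
      \<longleftrightarrow> f absolutely_integrable_on T \<and> integral T f = b"
      unfolding im[symmetric] using deriv inj
      by (intro has_absolute_integral_change_of_variables_1') (auto intro: has_field_derivative_at_within)
    then show ?thesis
      using that nonneg by (subst (1 2) fin_iff) auto
  qed
  show ?thesis
  proof (cases "?L")
    case (real b) then show ?thesis using iff[of b] by simp
  next
    case top
    show ?thesis
    proof (cases "?R")
      case (real b) then show ?thesis using iff[of b] by simp
    qed (use top in simp)
  qed
qed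

lemma set_nn_integral_square_substitution:
  fixes f :: "real \<Rightarrow> real"
  assumes k: "k > 0" and [measurable]: "f \<in> borel_measurable borel" and nonneg: "\<And>u. 0 \<le> f u"
  shows "(\<integral>\<^sup>+u\<in>{0<..}. ennreal (f u) \<partial>lborel) = (\<integral>\<^sup>+y\<in>{0<..}. ennreal (\<bar>2 * y / k\<bar> * f (y\<^sup>2 / k)) \<partial>lborel)"
proof (rule set_nn_integral_change_of_variables)
  show "((\<lambda>y. y\<^sup>2 / k) has_real_derivative 2 * y / k) (at y)" for y
    using k by (auto intro!: derivative_eq_intros)
  show "inj_on (\<lambda>y. y\<^sup>2 / k) {0<..}"
    using k by (auto intro!: inj_onI simp: power2_eq_iff)
  show "(\<lambda>y. y\<^sup>2 / k) ` {0<..} = {0<..}"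
  proof (intro equalityI subsetI)
    fix u :: real assume u: "u \<in> {0<..}"
    then have "u = (sqrt (k * u))\<^sup>2 / k" "sqrt (k * u) \<in> {0<..}" using k by simp_all
    then show "u \<in> (\<lambda>y. y\<^sup>2 / k) ` {0<..}" by blast
  qed (use k in auto)
qed (use nonneg in auto)

lemma nn_integral_reflect:
  fixes F :: "real \<Rightarrow> ennreal"
  assumes [measurable]: "F \<in> borel_measurable borel"
  shows "(\<integral>\<^sup>+x. F x \<partial>lborel) = (\<integral>\<^sup>+x\<in>{0..}. (F x + F (- x)) \<partial>lborel)"
proof -
  have "(\<integral>\<^sup>+x. F x \<partial>lborel) = (\<integral>\<^sup>+x. F x * indicator {0..} x + F x * indicator {..<0} x \<partial>lborel)"
    by (intro nn_integral_cong) (simp split: split_indicator)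
  also have "\<dots> = (\<integral>\<^sup>+x\<in>{0..}. F x \<partial>lborel) + (\<integral>\<^sup>+x\<in>{..<0}. F x \<partial>lborel)"
    by (rule nn_integral_add) measurable
  also have "(\<integral>\<^sup>+x\<in>{..<0}. F x \<partial>lborel)
      = ennreal \<bar>-1\<bar> * (\<integral>\<^sup>+x. F (0 + (-1) * x) * indicator {..<0} (0 + (-1) * x) \<partial>lborel)"
    by (rule nn_integral_real_affine) simp_all
  also have "\<dots> = (\<integral>\<^sup>+x\<in>{0..}. F (- x) \<partial>lborel)"
  proof -
    have "AE x in lborel. F (0 + (-1) * x) * indicator {..<0} (0 + (-1) * x) = F (- x) * indicator {0..} x"
      using AE_lborel_singleton[of 0] by eventually_elim (simp split: split_indicator)
    from nn_integral_cong_AE[OF this] show ?thesis by simp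
  qed
  also have "(\<integral>\<^sup>+x\<in>{0..}. F x \<partial>lborel) + \<dots> = (\<integral>\<^sup>+x. F x * indicator {0..} x + F (- x) * indicator {0..} x \<partial>lborel)"
    by (rule nn_integral_add[symmetric]) measurable
  also have "\<dots> = (\<integral>\<^sup>+x\<in>{0..}. (F x + F (- x)) \<partial>lborel)"
    by (intro nn_integral_cong) (simp split: split_indicator)
  finally show ?thesis .
qed

lemma nn_integral_swap_lborel:
  fixes f :: "real \<Rightarrow> real \<Rightarrow> ennreal"
  assumes "case_prod f \<in> borel_measurable (lborel \<Otimes>\<^sub>M lborel)"
  shows "(\<integral>\<^sup>+y. (\<integral>\<^sup>+x. f x y \<partial>lborel) \<partial>lborel) = (\<integral>\<^sup>+x. (\<integral>\<^sup>+y. f x y \<partial>lborel) \<partial>lborel)"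
  by (rule lborel_pair.Fubini'[OF assms])

lemma lborel_integral_reflect:
  fixes f :: "real \<Rightarrow> real"
  shows "integrable lborel (\<lambda>y. f (- y)) \<longleftrightarrow> integrable lborel f"
    "(\<integral>y. f (- y) \<partial>lborel) = (\<integral>y. f y \<partial>lborel)"
  using lborel_integrable_real_affine_iff[of "-1" f 0] lborel_integral_real_affine[of "-1" f 0] by simp_all

section \<open>The modified Bessel function of the second kind\<close>

lemma bessel_K_uminus: "bessel_K (- p) x = bessel_K p x"
  by (simp add: bessel_K_def)

lemma borel_measurable_bessel_K [measurable]: "bessel_K p \<in> borel_measurable borel"
  unfolding bessel_K_def[abs_def] set_lebesgue_integral_def cosh_def by measurable

lemma bessel_K_nonneg: "0 \<le> bessel_K p x"
  unfolding bessel_K_def set_lebesgue_integral_def by (intro integral_nonneg_AE) (auto simp: cosh_def)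

lemma exp_minus_le_fact_div_power:
  fixes u :: real
  assumes "u > 0"
  shows "exp (- u) \<le> fact m / u ^ m"
proof -
  have "u ^ m / fact m \<le> exp u"
  proof -
    have "(\<Sum>k\<in>{m}. inverse (fact k) * u ^ k) \<le> (\<Sum>k. inverse (fact k) * u ^ k)"
      using assms summable_exp[of u] by (intro sum_le_suminf) (auto simp: )
    then show ?thesis by (simp add: exp_def field_simps scaleR_conv_of_real)
  qed
  then show ?thesis
    using assms by (simp add: exp_minus field_simps)
qed

lemma nn_integral_Gamma:
  assumes "a > 0"
  shows "(\<integral>\<^sup>+w\<in>{0<..}. ennreal (w powr (a - 1) * exp (- w)) \<partial>lborel) = ennreal (Gamma a)"
proof -
  have "(\<integral>\<^sup>+w\<in>{0<..}. ennreal (w powr (a - 1) * exp (- w)) \<partial>lborel)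
      = (\<integral>\<^sup>+w. ennreal (indicator {0..} w * w powr (a - 1) / exp w) \<partial>lborel)"
    by (intro nn_integral_cong) (simp add: exp_minus divide_inverse split: split_indicator)
  then show ?thesis
    unfolding Gamma_conv_nn_integral_real[OF assms] .
qed

text \<open>
  The factor \<open>exp (- x\<^sup>2 / (4 w))\<close> decays faster than any power of \<open>w\<close> as \<open>w\<close> tends to \<open>0\<close>. Trading it for
  \<open>w ^ m\<close> raises the exponent until a convergent gamma integral is reached, whatever the sign of \<open>p\<close>.
\<close>

lemma bessel_K_integral_finite:
  assumes "x \<noteq> 0"
  shows "(\<integral>\<^sup>+w\<in>{0<..}. ennreal (w powr (p - 1) * exp (- w - x\<^sup>2 / (4 * w))) \<partial>lborel) < \<infinity>"
proof -
  \<comment> \<open>Enough powers of \<open>w\<close> to make the exponent of the gamma integral positive.\<close>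
  obtain m :: nat where "- p < real m" using reals_Archimedean2 by blast
  then have m: "p + real m > 0" by simp
  define C where "C = fact m / (x\<^sup>2 / 4) ^ m"
  have "(\<integral>\<^sup>+w\<in>{0<..}. ennreal (w powr (p - 1) * exp (- w - x\<^sup>2 / (4 * w))) \<partial>lborel)
      \<le> (\<integral>\<^sup>+w. ennreal C * (ennreal (w powr (p + real m - 1) * exp (- w)) * indicator {0<..} w) \<partial>lborel)"
  proof (intro nn_integral_mono)
    fix w :: real
    show "ennreal (w powr (p - 1) * exp (- w - x\<^sup>2 / (4 * w))) * indicator {0<..} w
      \<le> ennreal C * (ennreal (w powr (p + real m - 1) * exp (- w)) * indicator {0<..} w)"
    proof (cases "w > 0")
      case True
      have "exp (- (x\<^sup>2 / (4 * w))) \<le> fact m / (x\<^sup>2 / (4 * w)) ^ m"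
        using True assms by (intro exp_minus_le_fact_div_power) simp
      also have "\<dots> = C * w powr real m"
        using True assms by (simp add: C_def powr_realpow power_divide power_mult_distrib)
      finally have "w powr (p - 1) * exp (- w) * exp (- (x\<^sup>2 / (4 * w))) \<le> w powr (p - 1) * exp (- w) * (C * w powr real m)"
        by (intro mult_left_mono) auto
      also have "\<dots> = C * (w powr (p + real m - 1) * exp (- w))"
        by (simp add: powr_add powr_diff)
      finally have "w powr (p - 1) * exp (- w - x\<^sup>2 / (4 * w)) \<le> C * (w powr (p + real m - 1) * exp (- w))"
        by (simp add: exp_diff exp_minus field_simps)
      then show ?thesis using True
        by (simp add: ennreal_mult'[symmetric] C_def)
    qed simp
  qed
  also have "\<dots> = ennreal C * ennreal (Gamma (p + real m))"
    using m by (subst nn_integral_cmult) (auto simp: nn_integral_Gamma)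
  also have "\<dots> < \<infinity>" by (simp add: ennreal_mult_less_top)
  finally show ?thesis .
qed

lemma bessel_K_two_sided:
  "(\<integral>\<^sup>+t. ennreal (exp (- x * cosh t) * exp (p * t)) \<partial>lborel)
     = 2 * (\<integral>\<^sup>+t\<in>{0..}. ennreal (exp (- x * cosh t) * cosh (p * t)) \<partial>lborel)"
proof -
  let ?h = "\<lambda>t::real. exp (- x * cosh t) * exp (p * t)"
  have [measurable]: "?h \<in> borel_measurable borel"
    "(\<lambda>t. exp (- x * cosh t) * cosh (p * t)) \<in> borel_measurable borel"
    unfolding cosh_def by measurable
  have "(\<integral>\<^sup>+t. ennreal (?h t) \<partial>lborel) = (\<integral>\<^sup>+t\<in>{0..}. (ennreal (?h t) + ennreal (?h (- t))) \<partial>lborel)"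
    by (rule nn_integral_reflect) measurable
  also have "\<dots> = (\<integral>\<^sup>+t. 2 * (ennreal (exp (- x * cosh t) * cosh (p * t)) * indicator {0..} t) \<partial>lborel)"
  proof (rule nn_integral_cong)
    fix t :: real
    have "?h t + ?h (- t) = 2 * (exp (- x * cosh t) * cosh (p * t))"
      by (simp add: cosh_field_def ring_distribs)
    then have "ennreal (?h t) + ennreal (?h (- t)) = 2 * ennreal (exp (- x * cosh t) * cosh (p * t))"
      by (subst ennreal_plus[symmetric]) (simp_all add: ennreal_mult')
    then show "(ennreal (?h t) + ennreal (?h (- t))) * indicator {0..} t
        = 2 * (ennreal (exp (- x * cosh t) * cosh (p * t)) * indicator {0..} t)"
      by (cases "0 \<le> t") simp_all
  qed
  also have "\<dots> = 2 * (\<integral>\<^sup>+t\<in>{0..}. ennreal (exp (- x * cosh t) * cosh (p * t)) \<partial>lborel)"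
    by (rule nn_integral_cmult) measurable
  finally show ?thesis .
qed

text \<open>
  The substitution \<open>w = (x / 2) exp t\<close> turns \<open>w + x\<^sup>2 / (4 w)\<close> into \<open>x cosh t\<close>.
\<close>

lemma nn_integral_exp_inverse_eq_cosh:
  assumes x: "x > 0"
  shows "(\<integral>\<^sup>+w\<in>{0<..}. ennreal (w powr (p - 1) * exp (- w - x\<^sup>2 / (4 * w))) \<partial>lborel)
    = ennreal ((x / 2) powr p) * (2 * (\<integral>\<^sup>+t\<in>{0..}. ennreal (exp (- x * cosh t) * cosh (p * t)) \<partial>lborel))"
proof -
  let ?f = "\<lambda>w. w powr (p - 1) * exp (- w - x\<^sup>2 / (4 * w))"
  let ?g = "\<lambda>t. x / 2 * exp t"
  let ?h = "\<lambda>t. exp (- x * cosh t) * exp (p * t)"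
  let ?I = "\<integral>\<^sup>+t\<in>{0..}. ennreal (exp (- x * cosh t) * cosh (p * t)) \<partial>lborel"
  have [measurable]: "?h \<in> borel_measurable borel"
    "(\<lambda>t. exp (- (x * cosh t)) * cosh (p * t)) \<in> borel_measurable borel"
    "(\<lambda>t. exp (- x * cosh t) * cosh (p * t)) \<in> borel_measurable borel"
    unfolding cosh_def by measurable
  have im: "range ?g = {0<..}"
  proof (intro equalityI subsetI)
    fix w :: real assume "w \<in> {0<..}"
    then have "w = ?g (ln (2 * w / x))" using x by simp
    then show "w \<in> range ?g" by blast
  qed (use x in auto)
  have "(\<integral>\<^sup>+w\<in>{0<..}. ennreal (?f w) \<partial>lborel) = (\<integral>\<^sup>+t\<in>UNIV. ennreal (\<bar>?g t\<bar> * ?f (?g t)) \<partial>lborel)"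
  proof (rule set_nn_integral_change_of_variables[where g = ?g and g' = ?g and S = UNIV])
    show "(?g has_real_derivative ?g t) (at t)" for t
      by (auto intro!: derivative_eq_intros)
    show "inj ?g" using x by (simp add: inj_on_def)
    show "range ?g = {0<..}" by (fact im)
  qed auto
  also have "\<dots> = (\<integral>\<^sup>+t. ennreal ((x / 2) powr p) * ennreal (?h t) \<partial>lborel)"
  proof (intro nn_integral_cong)
    fix t :: real
    have g: "?g t > 0" using x by simp
    have "?g t * (?g t) powr (p - 1) = (?g t) powr p"
      using g by (simp add: powr_diff)
    also have "\<dots> = exp (p * ln (x / 2) + p * t)"
      using x by (simp add: powr_def ln_mult_pos[of "x / 2" "exp t", simplified] distrib_left)
    also have "\<dots> = (x / 2) powr p * exp (p * t)"
      using x by (simp add: powr_def exp_add)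
    finally have 1: "?g t * (?g t) powr (p - 1) = (x / 2) powr p * exp (p * t)" .
    have 2: "- ?g t - x\<^sup>2 / (4 * ?g t) = - x * cosh t"
      using x by (simp add: cosh_def exp_minus power2_eq_square divide_simps) (simp add: algebra_simps)?
    have "\<bar>?g t\<bar> * ?f (?g t) = (?g t * (?g t) powr (p - 1)) * exp (- ?g t - x\<^sup>2 / (4 * ?g t))"
      using g by (simp only: abs_of_pos mult.assoc)
    also have "\<dots> = (x / 2) powr p * ?h t"
      unfolding 1 2 by simp
    finally show "ennreal (\<bar>?g t\<bar> * ?f (?g t)) * indicator UNIV t = ennreal ((x / 2) powr p) * ennreal (?h t)"
      by (simp add: ennreal_mult' del: times_divide_eq_left times_divide_eq_right)
  qed
  also have "\<dots> = ennreal ((x / 2) powr p) * (2 * ?I)"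
    unfolding bessel_K_two_sided[symmetric] by (rule nn_integral_cmult) measurable
  finally show ?thesis .
qed

lemma nn_integral_bessel_K:
  assumes x: "x > 0"
  shows "(\<integral>\<^sup>+t\<in>{0..}. ennreal (exp (- x * cosh t) * cosh (p * t)) \<partial>lborel) = ennreal (bessel_K p x)"
proof -
  let ?I = "\<integral>\<^sup>+t\<in>{0..}. ennreal (exp (- x * cosh t) * cosh (p * t)) \<partial>lborel"
  have [measurable]: "(\<lambda>t. exp (- (x * cosh t)) * cosh (p * t)) \<in> borel_measurable borel"
    unfolding cosh_def by measurable
  have "?I < \<infinity>"
    using bessel_K_integral_finite[of x p] x unfolding nn_integral_exp_inverse_eq_cosh[OF x]
    by (auto simp: ennreal_mult_less_top)
  moreover have "bessel_K p x = enn2real ?I"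
    unfolding bessel_K_def set_lebesgue_integral_def
    by (subst integral_eq_nn_integral) (auto intro!: arg_cong[where f=enn2real] nn_integral_cong split: split_indicator)
  ultimately show ?thesis by simp
qed

text \<open>
  In this representation \<open>x\<close> occurs only in a Gaussian factor. Integrals of \<open>K\<close> over \<open>x\<close> therefore become
  elementary once the order of integration is exchanged.
\<close>

lemma bessel_K_integral_representation:
  assumes x: "x > 0"
  shows "(\<integral>\<^sup>+w\<in>{0<..}. ennreal (w powr (p - 1) * exp (- w - x\<^sup>2 / (4 * w))) \<partial>lborel)
    = ennreal (2 * (x / 2) powr p * bessel_K p x)"
  unfolding nn_integral_exp_inverse_eq_cosh[OF x] nn_integral_bessel_K[OF x]
  by (simp add: ennreal_mult mult_ac bessel_K_nonneg)

lemma bessel_K_mono: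
  assumes "x > 0" "\<bar>p\<bar> \<le> \<bar>q\<bar>"
  shows "bessel_K p x \<le> bessel_K q x"
proof -
  have "ennreal (bessel_K p x) \<le> ennreal (bessel_K q x)"
    unfolding nn_integral_bessel_K[OF assms(1), symmetric]
  proof (rule nn_integral_mono)
    fix t :: real
    show "ennreal (exp (- x * cosh t) * cosh (p * t)) * indicator {0..} t
        \<le> ennreal (exp (- x * cosh t) * cosh (q * t)) * indicator {0..} t"
    proof (cases "0 \<le> t")
      case True
      have "cosh (\<bar>p\<bar> * t) \<le> cosh (\<bar>q\<bar> * t)"
        using True assms by (subst cosh_real_nonneg_le_iff) (auto intro: mult_right_mono)
      moreover have "cosh (\<bar>r\<bar> * t) = cosh (r * t)" for r
        by (simp add: abs_if)
      ultimately show ?thesis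
        using True by (auto intro!: ennreal_leI mult_left_mono)
    qed simp
  qed
  then show ?thesis by (simp add: bessel_K_nonneg)
qed

text \<open>
  Dropping the factor \<open>exp (- x\<^sup>2 / (4 w))\<close> from the representation leaves a gamma integral; monotonicity
  in the order covers all \<open>p\<close> with \<open>\<bar>p\<bar> \<le> a\<close>. This controls \<open>K\<close> near \<open>0\<close>, including the
  logarithmic singularity of \<open>K\<close> of order \<open>0\<close>.
\<close>

lemma powr_bessel_K_le_Gamma:
  assumes "x > 0" "\<bar>p\<bar> \<le> a" "a > 0"
  shows "x powr a * bessel_K p x \<le> 2 powr (a - 1) * Gamma a"
proof -
  have "ennreal (2 * (x / 2) powr a * bessel_K a x) \<le> (\<integral>\<^sup>+w\<in>{0<..}. ennreal (w powr (a - 1) * exp (- w)) \<partial>lborel)"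
    unfolding bessel_K_integral_representation[OF assms(1), symmetric]
    by (intro nn_integral_mono) (auto intro!: ennreal_leI mult_left_mono split: split_indicator)
  then have "2 * (x / 2) powr a * bessel_K a x \<le> Gamma a"
    using assms by (simp add: nn_integral_Gamma Gamma_real_pos less_imp_le)
  then have "2 powr (a - 1) * (2 * (x / 2) powr a * bessel_K a x) \<le> 2 powr (a - 1) * Gamma a"
    by (intro mult_left_mono) auto
  moreover have "2 powr (a - 1) * (2 * (x / 2) powr a * bessel_K a x) = x powr a * bessel_K a x"
    using assms by (simp add: powr_diff powr_divide)
  moreover have "x powr a * bessel_K p x \<le> x powr a * bessel_K a x"
    using assms by (intro mult_left_mono bessel_K_mono) auto
  ultimately show ?thesis by linarith
qed

lemma tendsto_exp_minus_square:
  fixes w :: real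
  assumes "w > 0"
  shows "((\<lambda>y::real. exp (- y\<^sup>2 / (4 * w))) \<longlongrightarrow> 0) at_top"
proof -
  have "filterlim (\<lambda>y::real. inverse (4 * w) * y\<^sup>2) at_top at_top"
    by (rule filterlim_tendsto_pos_mult_at_top[OF tendsto_const _ filterlim_pow_at_top[OF _ filterlim_ident]])
       (use assms in simp_all)
  then have "filterlim (\<lambda>y::real. - (inverse (4 * w) * y\<^sup>2)) at_bot at_top"
    by (rule filterlim_uminus_at_top[THEN iffD1])
  also have "(\<lambda>y. - (inverse (4 * w) * y\<^sup>2)) = (\<lambda>y. - y\<^sup>2 / (4 * w))"
    using assms by (simp add: field_simps)
  finally show ?thesis
    by (rule filterlim_compose[OF exp_at_bot])
qed

lemma nn_integral_gaussian_tail: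
  fixes w x :: real
  assumes w: "w > 0" and x: "x \<ge> 0"
  shows "(\<integral>\<^sup>+y\<in>{x..}. ennreal (y / (2 * w) * exp (- y\<^sup>2 / (4 * w))) \<partial>lborel) = ennreal (exp (- x\<^sup>2 / (4 * w)))"
proof -
  have "(\<integral>\<^sup>+y\<in>{x..}. ennreal (y / (2 * w) * exp (- y\<^sup>2 / (4 * w))) \<partial>lborel) = 0 - (- exp (- x\<^sup>2 / (4 * w)))"
  proof (rule nn_integral_FTC_atLeast)
    show "((\<lambda>y::real. - exp (- y\<^sup>2 / (4 * w))) has_real_derivative y / (2 * w) * exp (- y\<^sup>2 / (4 * w))) (at y)" for y
      using w by (auto intro!: derivative_eq_intros)
    show "((\<lambda>y::real. - exp (- y\<^sup>2 / (4 * w))) \<longlongrightarrow> 0) at_top"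
      using tendsto_minus[OF tendsto_exp_minus_square[OF w]] by simp
    show "0 \<le> y / (2 * w) * exp (- y\<^sup>2 / (4 * w))" if "x \<le> y" for y
      using w x that by simp
  qed measurable
  then show ?thesis by simp
qed

text \<open>
  This is the recurrence \<open>(x powr p * K\<^sub>p)' = - x powr p * K\<^bsub>p-1\<^esub>\<close> in integrated form. It follows from
  Tonelli's theorem: in the representation of order \<open>p - 1\<close> the inner integral over \<open>y\<close> is a Gaussian tail,
  and the remaining integral over \<open>w\<close> represents order \<open>p\<close>.
\<close>

lemma nn_integral_bessel_K_tail:
  assumes x: "x > 0"
  shows "(\<integral>\<^sup>+y\<in>{x..}. ennreal (y powr p * bessel_K (p - 1) y) \<partial>lborel) = ennreal (x powr p * bessel_K p x)"
proof -
  let ?k = "\<lambda>q y w. w powr (q - 1) * exp (- w - y\<^sup>2 / (4 * w))"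
  have *: "ennreal (y powr p * bessel_K (p - 1) y) =
      ennreal (2 powr (p - 1) * y / 2) * (\<integral>\<^sup>+w\<in>{0<..}. ennreal (?k (p - 1) y w) \<partial>lborel)" if "y > 0" for y
  proof -
    have "y powr p = y * y powr (p - 1)" using that by (simp add: powr_diff)
    moreover have "2 powr (p - 1) * (y / 2) powr (p - 1) = y powr (p - 1)"
      using that by (simp add: powr_mult[symmetric])
    ultimately have "y powr p * bessel_K (p - 1) y = (2 powr (p - 1) * y / 2) * (2 * (y / 2) powr (p - 1) * bessel_K (p - 1) y)"
      by (simp add: mult_ac)
    also have "ennreal \<dots> = ennreal (2 powr (p - 1) * y / 2) * ennreal (2 * (y / 2) powr (p - 1) * bessel_K (p - 1) y)"
      using that by (intro ennreal_mult) (simp_all add: bessel_K_nonneg)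
    finally show ?thesis
      using that by (simp only: bessel_K_integral_representation)
  qed
  let ?E = "\<lambda>y w. ennreal (y / (2 * w) * exp (- y\<^sup>2 / (4 * w))) * indicator {x..} y"
  let ?C = "\<lambda>w. ennreal (2 powr (p - 1)) * (ennreal (w powr (p - 1) * exp (- w)) * indicator {0<..} w)"
  have "(\<integral>\<^sup>+y\<in>{x..}. ennreal (y powr p * bessel_K (p - 1) y) \<partial>lborel)
      = (\<integral>\<^sup>+y. (\<integral>\<^sup>+w. ?C w * ?E y w \<partial>lborel) \<partial>lborel)"
  proof (rule nn_integral_cong)
    fix y :: real
    show "ennreal (y powr p * bessel_K (p - 1) y) * indicator {x..} y = (\<integral>\<^sup>+w. ?C w * ?E y w \<partial>lborel)"
    proof (cases "x \<le> y")
      case True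
      then have y: "y > 0" using x by simp
      have "ennreal (y powr p * bessel_K (p - 1) y) * indicator {x..} y =
        (\<integral>\<^sup>+w. ennreal (2 powr (p - 1) * y / 2) * (ennreal (?k (p - 1) y w) * indicator {0<..} w) \<partial>lborel)"
        using True y by (subst *) (simp_all add: nn_integral_cmult)
      also have "\<dots> = (\<integral>\<^sup>+w. ?C w * ?E y w \<partial>lborel)"
      proof (rule nn_integral_cong)
        fix w :: real
        show "ennreal (2 powr (p - 1) * y / 2) * (ennreal (?k (p - 1) y w) * indicator {0<..} w) = ?C w * ?E y w"
        proof (cases "w > 0")
          case w: True
          have "2 powr (p - 1) * y / 2 * ?k (p - 1) y w
              = 2 powr (p - 1) * (w powr (p - 1) * exp (- w)) * (y / (2 * w) * exp (- y\<^sup>2 / (4 * w)))"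
          proof -
            have "exp (- w - y\<^sup>2 / (4 * w)) = exp (- w) * exp (- y\<^sup>2 / (4 * w))"
              by (simp add: exp_add[symmetric])
            moreover have "w powr (p - 1 - 1) = w powr (p - 1) / w"
              using w by (simp only: powr_diff[of w "p - 1" 1] powr_one less_imp_le)
            ultimately show ?thesis by (simp only: mult_ac times_divide_eq_left times_divide_eq_right divide_divide_eq_left)
          qed
          then show ?thesis
            using w y True by (simp only: ennreal_mult[symmetric] indicator_simps greaterThan_iff atLeast_iff mult_1_right
              powr_ge_zero mult_nonneg_nonneg exp_ge_zero divide_nonneg_nonneg less_imp_le zero_le_numeral mult.assoc)
        qed simp
      qed
      finally show ?thesis .
    qed simp
  qed
  also have "\<dots> = (\<integral>\<^sup>+w. (\<integral>\<^sup>+y. ?C w * ?E y w \<partial>lborel) \<partial>lborel)"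
    by (rule nn_integral_swap_lborel) measurable
  also have "\<dots> = (\<integral>\<^sup>+w. ennreal (2 powr (p - 1)) * (ennreal (?k p x w) * indicator {0<..} w) \<partial>lborel)"
  proof (rule nn_integral_cong)
    fix w :: real
    show "(\<integral>\<^sup>+y. ?C w * ?E y w \<partial>lborel) = ennreal (2 powr (p - 1)) * (ennreal (?k p x w) * indicator {0<..} w)"
    proof (cases "w > 0")
      case True
      have "(\<integral>\<^sup>+y. ?C w * ?E y w \<partial>lborel) = ?C w * ennreal (exp (- x\<^sup>2 / (4 * w)))"
        using True x by (simp only: nn_integral_gaussian_tail[symmetric] less_imp_le) (rule nn_integral_cmult, measurable)
      also have "\<dots> = ennreal (2 powr (p - 1)) * (ennreal (?k p x w) * indicator {0<..} w)"
        using True by (simp add: ennreal_mult'[symmetric] mult.assoc exp_add[symmetric])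
      finally show ?thesis .
    qed simp
  qed
  also have "\<dots> = ennreal (2 powr (p - 1)) * ennreal (2 * (x / 2) powr p * bessel_K p x)"
    unfolding bessel_K_integral_representation[OF x, symmetric] by (rule nn_integral_cmult) measurable
  also have "\<dots> = ennreal (2 powr (p - 1) * (2 * (x / 2) powr p * bessel_K p x))"
    by (rule ennreal_mult[symmetric]) (simp_all add: bessel_K_nonneg)
  also have "2 powr (p - 1) * (2 * (x / 2) powr p * bessel_K p x) = x powr p * bessel_K p x"
    using x by (simp add: powr_diff powr_divide)
  finally show ?thesis .
qed

lemma integrable_bessel_K_tail:
  assumes "x > 0"
  shows "set_integrable lborel {x..} (\<lambda>y. y powr p * bessel_K (p - 1) y)"
    "(LBINT y:{x..}. y powr p * bessel_K (p - 1) y) = x powr p * bessel_K p x"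
proof -
  have "(\<integral>\<^sup>+y. ennreal (indicator {x..} y *\<^sub>R (y powr p * bessel_K (p - 1) y)) \<partial>lborel)
      = (\<integral>\<^sup>+y\<in>{x..}. ennreal (y powr p * bessel_K (p - 1) y) \<partial>lborel)"
    by (intro nn_integral_cong) (simp split: split_indicator)
  also have "\<dots> = ennreal (x powr p * bessel_K p x)"
    by (rule nn_integral_bessel_K_tail[OF assms])
  finally have "has_bochner_integral lborel (\<lambda>y. indicator {x..} y *\<^sub>R (y powr p * bessel_K (p - 1) y)) (x powr p * bessel_K p x)"
    by (intro has_bochner_integral_nn_integral) (auto simp: bessel_K_nonneg)
  then show "set_integrable lborel {x..} (\<lambda>y. y powr p * bessel_K (p - 1) y)"
    "(LBINT y:{x..}. y powr p * bessel_K (p - 1) y) = x powr p * bessel_K p x"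
    by (simp_all add: has_bochner_integral_iff set_integrable_def set_lebesgue_integral_def)
qed

lemma bessel_K_tail_split:
  assumes "0 < a" "a \<le> x"
  shows "x powr p * bessel_K p x = a powr p * bessel_K p a - integral {a..x} (\<lambda>y. y powr p * bessel_K (p - 1) y)"
    "(\<lambda>y. y powr p * bessel_K (p - 1) y) integrable_on {a..x}"
proof -
  let ?f = "\<lambda>y. y powr p * bessel_K (p - 1) y"
  have int: "set_integrable lborel {a..} ?f" by (rule integrable_bessel_K_tail) fact
  have i1: "set_integrable lborel {a..x} ?f" and i2: "set_integrable lborel {x<..} ?f"
    using assms by (auto intro: set_integrable_subset[OF int])
  have "a powr p * bessel_K p a = (LBINT y:{a..x} \<union> {x<..}. ?f y)"
    using assms by (subst integrable_bessel_K_tail(2)[symmetric]) (auto intro!: arg_cong2[where f = "set_lebesgue_integral lborel"])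
  also have "\<dots> = (LBINT y:{a..x}. ?f y) + (LBINT y:{x<..}. ?f y)"
    by (rule set_integral_Un) (use i1 i2 in auto)
  also have "(LBINT y:{x<..}. ?f y) = (LBINT y:{x..}. ?f y)"
    unfolding set_lebesgue_integral_def
  proof (rule integral_cong_AE)
    show "AE y in lborel. indicator {x<..} y *\<^sub>R ?f y = indicator {x..} y *\<^sub>R ?f y"
      using AE_lborel_singleton[of x] by eventually_elim (simp split: split_indicator)
  qed auto
  also have "\<dots> = x powr p * bessel_K p x"
    using assms by (intro integrable_bessel_K_tail(2)) simp
  also have "(LBINT y:{a..x}. ?f y) = integral {a..x} ?f"
    by (rule set_borel_integral_eq_integral(2)[OF i1])
  finally show "x powr p * bessel_K p x = a powr p * bessel_K p a - integral {a..x} ?f" by simp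
  show "?f integrable_on {a..x}"
    by (rule set_borel_integral_eq_integral(1)[OF i1])
qed

text \<open>
  The integrated recurrence writes \<open>K\<^sub>p\<close> as an indefinite integral, and those are continuous.
  Applied to order \<open>p - 1\<close> as well, this makes the integrand continuous, so that the recurrence can
  then be differentiated.
\<close>

lemma isCont_bessel_K:
  assumes "x > 0"
  shows "isCont (bessel_K p) x"
proof -
  define a b where "a = x / 2" and "b = 2 * x"
  have ab: "0 < a" "a < x" "x < b" using assms by (auto simp: a_def b_def)
  have "continuous_on {a..b} (\<lambda>z. z powr - p * (a powr p * bessel_K p a - integral {a..z} (\<lambda>y. y powr p * bessel_K (p - 1) y)))"
    using ab by (intro continuous_intros indefinite_integral_continuous_1 bessel_K_tail_split(2)) auto
  also have "?this \<longleftrightarrow> continuous_on {a..b} (bessel_K p)"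
    using ab by (intro continuous_on_cong refl) (auto simp: bessel_K_tail_split(1)[symmetric] powr_minus)
  finally show ?thesis
    using ab by (auto intro: continuous_on_interior)
qed

lemma DERIV_powr_bessel_K:
  assumes "x > 0"
  shows "((\<lambda>x. x powr p * bessel_K p x) has_real_derivative - (x powr p * bessel_K (p - 1) x)) (at x)"
proof -
  define a b where "a = x / 2" and "b = 2 * x"
  have ab: "0 < a" "a < x" "x < b" using assms by (auto simp: a_def b_def)
  let ?f = "\<lambda>y. y powr p * bessel_K (p - 1) y"
  have "continuous_on {a..b} ?f"
    using ab by (intro continuous_at_imp_continuous_on ballI continuous_intros isCont_bessel_K) auto
  then have "((\<lambda>z. integral {a..z} ?f) has_real_derivative ?f x) (at x within {a..b})"
    using ab by (intro integral_has_real_derivative) auto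
  then have "((\<lambda>z. integral {a..z} ?f) has_real_derivative ?f x) (at x)"
    using ab by (simp add: at_within_Icc_at)
  from DERIV_diff[OF DERIV_const this]
  have "((\<lambda>z. a powr p * bessel_K p a - integral {a..z} ?f) has_real_derivative - ?f x) (at x)"
    by simp
  then show ?thesis
  proof (rule has_field_derivative_transform_within_open[where S = "{a<..}"])
    show "a powr p * bessel_K p a - integral {a..z} ?f = z powr p * bessel_K p z" if "z \<in> {a<..}" for z
      using that ab by (intro bessel_K_tail_split(1)[symmetric]) auto
  qed (use ab in auto)
qed

lemma nn_integral_gaussian_moment:
  assumes w: "w > 0" and q: "q > -1"
  shows "(\<integral>\<^sup>+y\<in>{0<..}. ennreal (y powr q * exp (- y\<^sup>2 / (4 * w))) \<partial>lborel)
    = ennreal ((4 * w) powr ((q + 1) / 2) * Gamma ((q + 1) / 2) / 2)"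
proof -
  define a where "a = (q + 1) / 2"
  have a: "a > 0" using q by (simp add: a_def)
  let ?f = "\<lambda>u. u powr (a - 1) * exp (- u)" and ?g = "\<lambda>y::real. y\<^sup>2 / (4 * w)"
  let ?h = "\<lambda>y. y powr q * exp (- y\<^sup>2 / (4 * w))"
  have "ennreal (Gamma a) = (\<integral>\<^sup>+u\<in>{0<..}. ennreal (?f u) \<partial>lborel)"
    using a by (rule nn_integral_Gamma[symmetric])
  also have "\<dots> = (\<integral>\<^sup>+y\<in>{0<..}. ennreal (\<bar>y / (2 * w)\<bar> * ?f (?g y)) \<partial>lborel)"
  proof -
    have eq: "y / (2 * w) = 2 * y / (4 * w)" for y by simp
    show ?thesis
      unfolding eq by (rule set_nn_integral_square_substitution) (use w in simp_all)
  qed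
  also have "\<dots> = (\<integral>\<^sup>+y. ennreal (2 * (4 * w) powr (- a)) * (ennreal (?h y) * indicator {0<..} y) \<partial>lborel)"
  proof (rule nn_integral_cong)
    fix y :: real
    show "ennreal (\<bar>y / (2 * w)\<bar> * ?f (?g y)) * indicator {0<..} y
      = ennreal (2 * (4 * w) powr (- a)) * (ennreal (?h y) * indicator {0<..} y)"
    proof (cases "y > 0")
      case True
      have 1: "(?g y) powr (a - 1) = y powr (2 * (a - 1)) * (4 * w) powr (1 - a)"
      proof -
        have "(?g y) powr (a - 1) = (y\<^sup>2) powr (a - 1) / (4 * w) powr (a - 1)"
          using w True by (simp add: powr_divide)
        also have "(y\<^sup>2) powr (a - 1) = y powr (2 * (a - 1))"
          using True powr_powr[of y 2 "a - 1"] by simp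
        also have "y powr (2 * (a - 1)) / (4 * w) powr (a - 1) = y powr (2 * (a - 1)) * (4 * w) powr (1 - a)"
          using powr_minus_divide[of "4 * w" "a - 1"] by simp
        finally show ?thesis .
      qed
      have 2: "y * y powr (2 * (a - 1)) = y powr q"
      proof -
        have "1 + 2 * (a - 1) = q" by (simp add: a_def field_simps)
        then show ?thesis using True by (simp only: powr_mult_base less_imp_le)
      qed
      have 3: "(4 * w) powr (1 - a) / (2 * w) = 2 * (4 * w) powr (- a)"
      proof -
        have "(4 * w) powr (1 - a) = 4 * w * (4 * w) powr (- a)"
          using w by (simp add: powr_mult_base)
        then show ?thesis using w by simp
      qed
      have "\<bar>y / (2 * w)\<bar> * ?f (?g y) = 2 * (4 * w) powr (- a) * ?h y"
      proof -
        have "\<bar>y / (2 * w)\<bar> = y / (2 * w)" using True w by simp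
        then have "\<bar>y / (2 * w)\<bar> * ?f (?g y) = (y * y powr (2 * (a - 1))) * ((4 * w) powr (1 - a) / (2 * w)) * exp (- ?g y)"
          unfolding 1 by simp
        then show ?thesis unfolding 2 3 by simp
      qed
      then show ?thesis
        using True by (simp only: indicator_simps greaterThan_iff mult_1_right ennreal_mult[symmetric]
          powr_ge_zero mult_nonneg_nonneg exp_ge_zero zero_le_numeral)
    qed simp
  qed
  also have "\<dots> = ennreal (2 * (4 * w) powr (- a)) * (\<integral>\<^sup>+y\<in>{0<..}. ennreal (?h y) \<partial>lborel)"
    by (rule nn_integral_cmult) measurable
  finally have "ennreal ((4 * w) powr a / 2) * ennreal (Gamma a)
      = ennreal ((4 * w) powr a / 2) * (ennreal (2 * (4 * w) powr (- a)) * (\<integral>\<^sup>+y\<in>{0<..}. ennreal (?h y) \<partial>lborel))"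
    by simp
  also have "\<dots> = (\<integral>\<^sup>+y\<in>{0<..}. ennreal (?h y) \<partial>lborel)"
    using w by (simp add: mult.assoc[symmetric] ennreal_mult'[symmetric] powr_minus)
  finally show ?thesis
    using a by (simp add: ennreal_mult'[symmetric] a_def)
qed

text \<open>
  The Mellin transform of \<open>K\<close>. After exchanging the integrals, a Gaussian moment over \<open>y\<close> produces
  \<open>\<Gamma>(A)\<close> together with the power \<open>w powr A\<close>; since \<open>\<nu> + A = B\<close>, the integral over \<open>w\<close> is \<open>\<Gamma>(B)\<close>.
\<close>

lemma nn_integral_powr_bessel_K:
  fixes \<mu> \<nu> A B :: real
  assumes index: "\<bar>\<nu>\<bar> < \<mu> + 1"
  defines "A \<equiv> (\<mu> - \<nu> + 1) / 2" and "B \<equiv> (\<mu> + \<nu> + 1) / 2"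
  shows "(\<integral>\<^sup>+y\<in>{0<..}. ennreal (y powr \<mu> * bessel_K \<nu> y) \<partial>lborel) = ennreal (2 powr (\<mu> - 1) * Gamma A * Gamma B)"
proof -
  have pos: "A > 0" "B > 0"
    using index by (auto simp: A_def B_def abs_if split: if_splits)
  let ?E = "\<lambda>y w. ennreal (y powr (\<mu> - \<nu>) * exp (- y\<^sup>2 / (4 * w))) * indicator {0<..} y"
  let ?C = "\<lambda>w. ennreal (2 powr (\<nu> - 1)) * (ennreal (w powr (\<nu> - 1) * exp (- w)) * indicator {0<..} w)"
  have "(\<integral>\<^sup>+y\<in>{0<..}. ennreal (y powr \<mu> * bessel_K \<nu> y) \<partial>lborel) = (\<integral>\<^sup>+y. (\<integral>\<^sup>+w. ?C w * ?E y w \<partial>lborel) \<partial>lborel)"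
  proof (rule nn_integral_cong)
    fix y :: real
    show "ennreal (y powr \<mu> * bessel_K \<nu> y) * indicator {0<..} y = (\<integral>\<^sup>+w. ?C w * ?E y w \<partial>lborel)"
    proof (cases "y > 0")
      case True
      let ?k = "\<lambda>w. w powr (\<nu> - 1) * exp (- w - y\<^sup>2 / (4 * w))"
      have "y powr \<mu> * bessel_K \<nu> y = (2 powr (\<nu> - 1) * y powr (\<mu> - \<nu>)) * (2 * (y / 2) powr \<nu> * bessel_K \<nu> y)"
        using True by (simp add: powr_diff powr_divide)
      also have "ennreal \<dots> = ennreal (2 powr (\<nu> - 1) * y powr (\<mu> - \<nu>)) * ennreal (2 * (y / 2) powr \<nu> * bessel_K \<nu> y)"
        by (rule ennreal_mult) (simp_all add: bessel_K_nonneg)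
      also have "\<dots> = (\<integral>\<^sup>+w. ennreal (2 powr (\<nu> - 1) * y powr (\<mu> - \<nu>)) * (ennreal (?k w) * indicator {0<..} w) \<partial>lborel)"
        unfolding bessel_K_integral_representation[OF True, symmetric] by (rule nn_integral_cmult[symmetric]) measurable
      also have "\<dots> = (\<integral>\<^sup>+w. ?C w * ?E y w \<partial>lborel)"
      proof (rule nn_integral_cong)
        fix w :: real
        show "ennreal (2 powr (\<nu> - 1) * y powr (\<mu> - \<nu>)) * (ennreal (?k w) * indicator {0<..} w) = ?C w * ?E y w"
        proof (cases "w > 0")
          case w: True
          have "exp (- w - y\<^sup>2 / (4 * w)) = exp (- w) * exp (- y\<^sup>2 / (4 * w))"
            by (simp add: exp_add[symmetric])
          then have "2 powr (\<nu> - 1) * y powr (\<mu> - \<nu>) * ?k w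
            = 2 powr (\<nu> - 1) * (w powr (\<nu> - 1) * exp (- w)) * (y powr (\<mu> - \<nu>) * exp (- y\<^sup>2 / (4 * w)))"
            by (simp only: mult_ac)
          then show ?thesis
            using w True by (simp only: ennreal_mult[symmetric] indicator_simps greaterThan_iff mult_1_right
              powr_ge_zero mult_nonneg_nonneg exp_ge_zero)
        qed simp
      qed
      finally show ?thesis using True by simp
    qed simp
  qed
  also have "\<dots> = (\<integral>\<^sup>+w. (\<integral>\<^sup>+y. ?C w * ?E y w \<partial>lborel) \<partial>lborel)"
    by (rule nn_integral_swap_lborel) measurable
  also have "\<dots> = (\<integral>\<^sup>+w. ennreal (2 powr (\<mu> - 1) * Gamma A) * (ennreal (w powr (B - 1) * exp (- w)) * indicator {0<..} w) \<partial>lborel)"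
  proof (rule nn_integral_cong)
    fix w :: real
    show "(\<integral>\<^sup>+y. ?C w * ?E y w \<partial>lborel) = ennreal (2 powr (\<mu> - 1) * Gamma A) * (ennreal (w powr (B - 1) * exp (- w)) * indicator {0<..} w)"
    proof (cases "w > 0")
      case True
      have A: "(\<mu> - \<nu> + 1) / 2 = A" by (simp add: A_def)
      have "\<mu> - \<nu> > -1" using index by linarith
      note moment = nn_integral_gaussian_moment[OF True this]
      have "(\<integral>\<^sup>+y. ?C w * ?E y w \<partial>lborel) = ?C w * ennreal ((4 * w) powr A * Gamma A / 2)"
        unfolding moment[unfolded A, symmetric] by (rule nn_integral_cmult) measurable
      also have "\<dots> = ennreal (2 powr (\<nu> - 1) * (w powr (\<nu> - 1) * exp (- w)) * ((4 * w) powr A * Gamma A / 2))"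
        using True pos by (simp add: ennreal_mult'[symmetric] less_imp_le)
      also have "2 powr (\<nu> - 1) * (w powr (\<nu> - 1) * exp (- w)) * ((4 * w) powr A * Gamma A / 2)
        = (2 powr (\<mu> - 1) * Gamma A) * (w powr (B - 1) * exp (- w))"
      proof -
        have 1: "(4 * w) powr A = 2 powr (\<mu> - \<nu> + 1) * w powr A"
          using True powr_powr[of 2 2 A] by (simp add: powr_mult A_def)
        have 2: "w powr (\<nu> - 1) * w powr A = w powr (B - 1)"
          by (simp add: powr_add[symmetric] A_def B_def field_simps)
        have 3: "2 powr (\<nu> - 1) * 2 powr (\<mu> - \<nu> + 1) / 2 = 2 powr (\<mu> - 1)"
        proof -
          have "2 powr (\<nu> - 1) * 2 powr (\<mu> - \<nu> + 1) = (2::real) powr ((\<mu> - 1) + 1)"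
            by (simp only: powr_add[symmetric]) simp
          also have "\<dots> = 2 powr (\<mu> - 1) * 2" by (simp only: powr_add powr_one zero_le_numeral)
          finally show ?thesis by simp
        qed
        have "2 powr (\<nu> - 1) * (w powr (\<nu> - 1) * exp (- w)) * ((4 * w) powr A * Gamma A / 2)
          = (2 powr (\<nu> - 1) * 2 powr (\<mu> - \<nu> + 1) / 2) * Gamma A * ((w powr (\<nu> - 1) * w powr A) * exp (- w))"
          unfolding 1 by (simp only: mult_ac times_divide_eq_left times_divide_eq_right)
        then show ?thesis unfolding 2 3 .
      qed
      finally show ?thesis
        using True pos by (simp add: ennreal_mult'[symmetric] less_imp_le)
    qed simp
  qed
  also have "\<dots> = ennreal (2 powr (\<mu> - 1) * Gamma A) * ennreal (Gamma B)"
    unfolding nn_integral_Gamma[OF pos(2), symmetric] by (rule nn_integral_cmult) measurable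
  also have "\<dots> = ennreal (2 powr (\<mu> - 1) * Gamma A * Gamma B)"
    using pos by (intro ennreal_mult[symmetric]) (auto intro!: mult_nonneg_nonneg Gamma_real_pos less_imp_le)
  finally show ?thesis .
qed

section \<open>Lommel functions\<close>

text \<open>
  The regularised \<open>0F1\<close>-type series behind both Lommel functions: up to a power of \<open>x\<close> they are its values
  at \<open>(x / 2)\<^sup>2\<close>, and the entire function is easier to differentiate than a series of real powers.
\<close>

definition gamma_quotient_series :: "real \<Rightarrow> real \<Rightarrow> real \<Rightarrow> real" where
  "gamma_quotient_series a b z = (\<Sum>j. inverse (Gamma (real j + a) * Gamma (real j + b)) * z ^ j)"

lemma Gamma_Suc_shift:
  fixes a :: real
  assumes "a > 0"
  shows "Gamma (real (Suc j) + a) = (real j + a) * Gamma (real j + a)"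
proof -
  have "real j + a \<notin> \<int>\<^sub>\<le>\<^sub>0" using assms by (auto dest: nonpos_Ints_nonpos)
  from Gamma_plus1[OF this] show ?thesis by (simp add: add_ac)
qed

lemma summable_gamma_quotient_series:
  assumes a: "a > 0" and b: "b > 0"
  shows "summable (\<lambda>j. inverse (Gamma (real j + a) * Gamma (real j + b)) * z ^ j)"
proof -
  let ?c = "\<lambda>j. inverse (Gamma (real j + a) * Gamma (real j + b))"
  obtain N :: nat where N: "2 * \<bar>z\<bar> + 1 \<le> real N" using real_arch_simple by blast
  show ?thesis
  proof (rule summable_ratio_test[of "1/2" N])
    fix j assume "N \<le> j"
    then have j: "2 * \<bar>z\<bar> + 1 \<le> real j" using N by linarith
    have pos: "Gamma (real j + a) > 0" "Gamma (real j + b) > 0"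
      using a b by (auto intro!: Gamma_real_pos)
    have "real j * 1 \<le> (real j + a) * (real j + b)"
      using a b j by (intro mult_mono) auto
    then have le: "2 * \<bar>z\<bar> \<le> (real j + a) * (real j + b)" using j by linarith
    have "norm (?c (Suc j) * z ^ Suc j) = \<bar>z\<bar> * inverse ((real j + a) * (real j + b)) * norm (?c j * z ^ j)"
      using a b pos by (simp add: Gamma_Suc_shift[OF a] Gamma_Suc_shift[OF b] abs_mult power_abs del: of_nat_Suc)
    also have "\<dots> \<le> 1 / 2 * norm (?c j * z ^ j)"
    proof (rule mult_right_mono)
      show "\<bar>z\<bar> * inverse ((real j + a) * (real j + b)) \<le> 1 / 2"
      proof -
        have "(real j + a) * (real j + b) > 0" using a b by (intro mult_pos_pos) auto
        then have "\<bar>z\<bar> / ((real j + a) * (real j + b)) \<le> 1 / 2"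
          using le by (subst pos_divide_le_eq) linarith+
        then show ?thesis by (simp only: divide_inverse)
      qed
    qed simp
    finally show "norm (?c (Suc j) * z ^ Suc j) \<le> 1 / 2 * norm (?c j * z ^ j)" .
  qed simp
qed

lemma isCont_gamma_quotient_series:
  assumes "a > 0" "b > 0"
  shows "isCont (gamma_quotient_series a b) z"
  unfolding gamma_quotient_series_def[abs_def]
  by (rule DERIV_isCont, rule termdiffs_strong_converges_everywhere, rule summable_gamma_quotient_series) (use assms in auto)

lemma gamma_quotient_series_nonneg:
  assumes "a > 0" "b > 0" "z \<ge> 0"
  shows "gamma_quotient_series a b z \<ge> 0"
  unfolding gamma_quotient_series_def using assms
  by (intro suminf_nonneg summable_gamma_quotient_series mult_nonneg_nonneg)
     (auto intro!: Gamma_real_pos less_imp_le)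

lemma gamma_quotient_series_shift:
  assumes "a > 0" "b > 0"
  shows "gamma_quotient_series a b z = inverse (Gamma a * Gamma b) + z * gamma_quotient_series (a + 1) (b + 1) z"
proof -
  let ?f = "\<lambda>j. inverse (Gamma (real j + a) * Gamma (real j + b)) * z ^ j"
  have "(\<Sum>j. ?f (Suc j)) = (\<Sum>j. z * (inverse (Gamma (real j + (a + 1)) * Gamma (real j + (b + 1))) * z ^ j))"
    by (simp add: mult_ac add_ac)
  also have "\<dots> = z * gamma_quotient_series (a + 1) (b + 1) z"
    unfolding gamma_quotient_series_def
    by (intro suminf_mult summable_gamma_quotient_series) (use assms in auto)
  finally have "(\<Sum>j. ?f (Suc j)) = z * gamma_quotient_series (a + 1) (b + 1) z" .
  moreover have "(\<Sum>j. ?f (Suc j)) = gamma_quotient_series a b z - ?f 0"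
    unfolding gamma_quotient_series_def by (rule suminf_split_head[OF summable_gamma_quotient_series[OF assms]])
  ultimately show ?thesis by simp
qed

text \<open>
  Termwise differentiation multiplies the coefficient of \<open>z powr (b + j)\<close> by \<open>b + j\<close>, which the functional
  equation of \<open>\<Gamma>\<close> absorbs by lowering the second parameter from \<open>b + 1\<close> to \<open>b\<close>.
\<close>

lemma DERIV_powr_gamma_quotient_series:
  assumes a: "a > 0" and b: "b > 0" and z: "z > 0"
  shows "((\<lambda>z. z powr b * gamma_quotient_series a (b + 1) z) has_real_derivative
    z powr (b - 1) * gamma_quotient_series a b z) (at z)"
proof -
  define c where "c j = inverse (Gamma (real j + a) * Gamma (real j + (b + 1)))" for j
  have sum_c: "summable (\<lambda>j. c j * y ^ j)" for y
    unfolding c_def using a b by (intro summable_gamma_quotient_series) auto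
  have P: "gamma_quotient_series a (b + 1) = (\<lambda>z. \<Sum>j. c j * z ^ j)"
    by (simp add: gamma_quotient_series_def[abs_def] c_def)
  define P' where "P' = (\<Sum>j. diffs c j * z ^ j)"
  have der: "(gamma_quotient_series a (b + 1) has_real_derivative P') (at z)"
    unfolding P P'_def by (rule termdiffs_strong_converges_everywhere) (rule sum_c)
  have sum_d: "summable (\<lambda>j. diffs c j * z ^ j)"
    by (rule termdiff_converges_all) (rule sum_c)
  have "(\<lambda>j. real j * c j * z ^ (j - Suc 0)) sums P'"
    unfolding P'_def by (rule diffs_equiv) (rule sum_d)
  then have "(\<lambda>j. z * (real j * c j * z ^ (j - Suc 0)) + b * (c j * z ^ j)) sums (z * P' + b * (\<Sum>j. c j * z ^ j))"
    by (intro sums_add sums_mult summable_sums sum_c)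
  moreover have "z * (real j * c j * z ^ (j - Suc 0)) + b * (c j * z ^ j)
      = inverse (Gamma (real j + a) * Gamma (real j + b)) * z ^ j" for j
  proof -
    have "real j + b \<noteq> 0" using b by linarith
    have "Gamma (real j + (b + 1)) = (real j + b) * Gamma (real j + b)"
      using Gamma_Suc_shift[OF b, of j] by (simp add: add_ac)
    then have c: "(real j + b) * c j = inverse (Gamma (real j + a) * Gamma (real j + b))"
      unfolding c_def using \<open>real j + b \<noteq> 0\<close> by simp
    have "z * (real j * c j * z ^ (j - Suc 0)) = real j * c j * z ^ j"
      by (cases j) auto
    then have "z * (real j * c j * z ^ (j - Suc 0)) + b * (c j * z ^ j) = (real j + b) * c j * z ^ j"
      by (simp only: ring_distribs mult.assoc)
    then show ?thesis unfolding c .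
  qed
  ultimately have eq: "z * P' + b * gamma_quotient_series a (b + 1) z = gamma_quotient_series a b z"
    by (simp add: gamma_quotient_series_def[of a b] P sums_iff)
  have "((\<lambda>z. z powr b * gamma_quotient_series a (b + 1) z) has_real_derivative
      b * z powr (b - 1) * gamma_quotient_series a (b + 1) z + P' * z powr b) (at z)"
    by (rule DERIV_mult[OF has_real_derivative_powr[OF z] der])
  also have "b * z powr (b - 1) * gamma_quotient_series a (b + 1) z + P' * z powr b
      = z powr (b - 1) * (z * P' + b * gamma_quotient_series a (b + 1) z)"
  proof -
    have "z powr b = z powr (b - 1) * z" using z by (simp add: powr_diff)
    then show ?thesis by (simp add: ring_distribs mult_ac)
  qed
  finally show ?thesis unfolding eq .
qed

lemma gamma_quotient_series_commute: "gamma_quotient_series a b z = gamma_quotient_series b a z"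
  by (simp add: gamma_quotient_series_def mult.commute)

lemma lommel_t_eq:
  assumes "x > 0" and that: "\<mu> + 3 > \<bar>\<nu>\<bar>"
  shows "lommel_t \<mu> \<nu> x = (x / 2) powr (\<mu> + 1) * gamma_quotient_series ((\<mu> - \<nu> + 3) / 2) ((\<mu> + \<nu> + 3) / 2) ((x / 2)\<^sup>2)"
proof -
  have "(x / 2) powr (\<mu> + 2 * real k + 1) = (x / 2) powr (\<mu> + 1) * ((x / 2)\<^sup>2) ^ k" for k
  proof -
    have "\<mu> + 2 * real k + 1 = (\<mu> + 1) + real (2 * k)" by simp
    then show ?thesis
      using assms by (simp only: powr_add powr_realpow power_mult half_gt_zero)
  qed
  then have "lommel_t \<mu> \<nu> x = (\<Sum>k. (x / 2) powr (\<mu> + 1) *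
     (inverse (Gamma (real k + (\<mu> - \<nu> + 3) / 2) * Gamma (real k + (\<mu> + \<nu> + 3) / 2)) * ((x / 2)\<^sup>2) ^ k))"
    unfolding lommel_t_def by (simp only: divide_inverse mult_ac)
  also have "\<dots> = (x / 2) powr (\<mu> + 1) * gamma_quotient_series ((\<mu> - \<nu> + 3) / 2) ((\<mu> + \<nu> + 3) / 2) ((x / 2)\<^sup>2)"
    unfolding gamma_quotient_series_def
    by (intro suminf_mult summable_gamma_quotient_series) (use that in \<open>simp_all add: abs_if split: if_splits\<close>)
  finally show ?thesis .
qed

lemma DERIV_half_square: "((\<lambda>x::real. (x / 2)\<^sup>2) has_real_derivative x / 2) (at x)"
  by (auto intro!: derivative_eq_intros)

context
  fixes \<mu> \<nu> A B :: real
  assumes index: "\<bar>\<nu>\<bar> < \<mu> + 1"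
  defines "A \<equiv> (\<mu> - \<nu> + 1) / 2" and "B \<equiv> (\<mu> + \<nu> + 1) / 2"
begin

lemma AB_pos: "A > 0" "B > 0"
  using index by (auto simp: A_def B_def abs_if split: if_splits)

lemma lommel_t_eq_upper:
  assumes "x > 0"
  shows "lommel_t \<mu> \<nu> x = (x / 2) powr (\<mu> + 1) * gamma_quotient_series (A + 1) (B + 1) ((x / 2)\<^sup>2)"
proof -
  have eq: "(\<mu> - \<nu> + 3) / 2 = A + 1" "(\<mu> + \<nu> + 3) / 2 = B + 1"
    by (simp_all add: A_def B_def field_simps)
  have "\<bar>\<nu>\<bar> < \<mu> + 3" using index by simp
  from lommel_t_eq[OF assms this] show ?thesis unfolding eq .
qed

lemma lommel_t_eq_lower:
  assumes "x > 0"
  shows "lommel_t (\<mu> - 1) (\<nu> - 1) x = (x / 2) powr \<mu> * gamma_quotient_series (A + 1) B ((x / 2)\<^sup>2)"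
proof -
  have eq: "(\<mu> - 1 - (\<nu> - 1) + 3) / 2 = A + 1" "(\<mu> - 1 + (\<nu> - 1) + 3) / 2 = B" "\<mu> - 1 + 1 = \<mu>"
    by (simp_all add: A_def B_def field_simps)
  have "\<bar>\<nu> - 1\<bar> < \<mu> - 1 + 3" using index by linarith
  from lommel_t_eq[OF assms this] show ?thesis unfolding eq .
qed

lemma half_square_powr: "x > 0 \<Longrightarrow> ((x / 2)\<^sup>2) powr c = (x / 2) powr (2 * c)" for x c :: real
  by (simp add: powr_powr[symmetric])

lemma DERIV_powr_lommel_t_upper:
  assumes x: "x > 0"
  shows "((\<lambda>x. x powr \<nu> * lommel_t \<mu> \<nu> x) has_real_derivative x powr \<nu> * lommel_t (\<mu> - 1) (\<nu> - 1) x) (at x)"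
proof -
  let ?F = "\<lambda>z. z powr B * gamma_quotient_series (A + 1) (B + 1) z"
  have z: "(x / 2)\<^sup>2 > 0" using x by simp
  have "((\<lambda>x. 2 powr \<nu> * ?F ((x / 2)\<^sup>2)) has_real_derivative
      2 powr \<nu> * (((x / 2)\<^sup>2) powr (B - 1) * gamma_quotient_series (A + 1) B ((x / 2)\<^sup>2) * (x / 2))) (at x)"
    using AB_pos z by (intro DERIV_cmult DERIV_chain2[OF DERIV_powr_gamma_quotient_series] DERIV_half_square) auto
  also have "2 powr \<nu> * (((x / 2)\<^sup>2) powr (B - 1) * gamma_quotient_series (A + 1) B ((x / 2)\<^sup>2) * (x / 2))
      = x powr \<nu> * lommel_t (\<mu> - 1) (\<nu> - 1) x"
  proof -
    have "((x / 2)\<^sup>2) powr (B - 1) * (x / 2) = (x / 2) powr (2 * (B - 1) + 1)"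
      using x by (simp only: half_square_powr powr_add powr_one half_gt_zero less_imp_le)
    also have "2 * (B - 1) + 1 = \<mu> + \<nu>" by (simp add: B_def field_simps)
    finally have 1: "((x / 2)\<^sup>2) powr (B - 1) * (x / 2) = (x / 2) powr \<mu> * (x / 2) powr \<nu>" by (simp only: powr_add)
    have 2: "x powr \<nu> = 2 powr \<nu> * (x / 2) powr \<nu>" using x by (simp add: powr_divide)
    have "2 powr \<nu> * (((x / 2)\<^sup>2) powr (B - 1) * gamma_quotient_series (A + 1) B ((x / 2)\<^sup>2) * (x / 2))
        = 2 powr \<nu> * (((x / 2)\<^sup>2) powr (B - 1) * (x / 2)) * gamma_quotient_series (A + 1) B ((x / 2)\<^sup>2)"
      by (simp only: mult_ac)
    also have "\<dots> = x powr \<nu> * lommel_t (\<mu> - 1) (\<nu> - 1) x"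
      unfolding 1 2 lommel_t_eq_lower[OF x] by (simp only: mult_ac)
    finally show ?thesis .
  qed
  finally show ?thesis
  proof (rule has_field_derivative_transform_within_open[where S = "{0<..}"])
    fix x :: real assume "x \<in> {0<..}"
    then have x: "x > 0" by simp
    have two_B: "2 * B = (\<mu> + 1) + \<nu>" by (simp add: B_def)
    have "((x / 2)\<^sup>2) powr B = (x / 2) powr (\<mu> + 1) * (x / 2) powr \<nu>"
      using x two_B by (simp only: half_square_powr powr_add[symmetric])
    moreover have "x powr \<nu> = 2 powr \<nu> * (x / 2) powr \<nu>" using x by (simp add: powr_divide)
    ultimately show "2 powr \<nu> * ?F ((x / 2)\<^sup>2) = x powr \<nu> * lommel_t \<mu> \<nu> x"
      unfolding lommel_t_eq_upper[OF x] by (simp only: mult_ac)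
  qed (use x in auto)
qed

text \<open>
  Lowering the other parameter of the series gives a series that starts one index earlier than the one
  of the first Lommel function. Its first term is the inhomogeneity that separates Lommel functions from
  Bessel functions.
\<close>

lemma DERIV_powr_lommel_t_lower:
  assumes x: "x > 0"
  shows "((\<lambda>x. x powr (1 - \<nu>) * lommel_t (\<mu> - 1) (\<nu> - 1) x) has_real_derivative
    x powr (1 - \<nu>) * (lommel_t \<mu> \<nu> x + (x / 2) powr (\<mu> - 1) / (Gamma A * Gamma B))) (at x)"
proof -
  let ?F = "\<lambda>z. z powr A * gamma_quotient_series B (A + 1) z"
  have z: "(x / 2)\<^sup>2 > 0" using x by simp
  have "((\<lambda>x. 2 powr (1 - \<nu>) * ?F ((x / 2)\<^sup>2)) has_real_derivative
      2 powr (1 - \<nu>) * (((x / 2)\<^sup>2) powr (A - 1) * gamma_quotient_series B A ((x / 2)\<^sup>2) * (x / 2))) (at x)"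
    using AB_pos z by (intro DERIV_cmult DERIV_chain2[OF DERIV_powr_gamma_quotient_series] DERIV_half_square) auto
  also have "2 powr (1 - \<nu>) * (((x / 2)\<^sup>2) powr (A - 1) * gamma_quotient_series B A ((x / 2)\<^sup>2) * (x / 2))
      = x powr (1 - \<nu>) * (lommel_t \<mu> \<nu> x + (x / 2) powr (\<mu> - 1) / (Gamma A * Gamma B))"
  proof -
    have "((x / 2)\<^sup>2) powr (A - 1) * (x / 2) = (x / 2) powr (2 * (A - 1) + 1)"
      using x by (simp only: half_square_powr powr_add powr_one half_gt_zero less_imp_le)
    also have "2 * (A - 1) + 1 = (\<mu> - 1) + (1 - \<nu>)" by (simp add: A_def field_simps)
    finally have 1: "((x / 2)\<^sup>2) powr (A - 1) * (x / 2) = (x / 2) powr (\<mu> - 1) * (x / 2) powr (1 - \<nu>)" by (simp only: powr_add)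
    have 2: "x powr (1 - \<nu>) = 2 powr (1 - \<nu>) * (x / 2) powr (1 - \<nu>)" using x by (simp add: powr_divide)
    have pw: "(x / 2) powr (\<mu> + 1) = (x / 2) powr (\<mu> - 1) * (x / 2)\<^sup>2"
    proof -
      have eq: "\<mu> + 1 = (\<mu> - 1) + real 2" by simp
      show ?thesis using x by (subst eq) (simp only: powr_add powr_realpow half_gt_zero)
    qed
    have 3: "lommel_t \<mu> \<nu> x + (x / 2) powr (\<mu> - 1) / (Gamma A * Gamma B)
        = (x / 2) powr (\<mu> - 1) * gamma_quotient_series B A ((x / 2)\<^sup>2)"
      unfolding lommel_t_eq_upper[OF x] pw gamma_quotient_series_commute[of B A] gamma_quotient_series_shift[OF AB_pos]
      by (simp only: distrib_left divide_inverse mult.assoc add.commute)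
    have "2 powr (1 - \<nu>) * (((x / 2)\<^sup>2) powr (A - 1) * gamma_quotient_series B A ((x / 2)\<^sup>2) * (x / 2))
        = 2 powr (1 - \<nu>) * (((x / 2)\<^sup>2) powr (A - 1) * (x / 2)) * gamma_quotient_series B A ((x / 2)\<^sup>2)"
      by (simp only: mult_ac)
    also have "\<dots> = x powr (1 - \<nu>) * (lommel_t \<mu> \<nu> x + (x / 2) powr (\<mu> - 1) / (Gamma A * Gamma B))"
      unfolding 1 2 3 by (simp only: mult_ac)
    finally show ?thesis .
  qed
  finally show ?thesis
  proof (rule has_field_derivative_transform_within_open[where S = "{0<..}"])
    fix x :: real assume "x \<in> {0<..}"
    then have x: "x > 0" by simp
    have two_A: "2 * A = \<mu> + (1 - \<nu>)" by (simp add: A_def)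
    have "((x / 2)\<^sup>2) powr A = (x / 2) powr \<mu> * (x / 2) powr (1 - \<nu>)"
      using x two_A by (simp only: half_square_powr powr_add[symmetric])
    moreover have "x powr (1 - \<nu>) = 2 powr (1 - \<nu>) * (x / 2) powr (1 - \<nu>)" using x by (simp add: powr_divide)
    ultimately show "2 powr (1 - \<nu>) * ?F ((x / 2)\<^sup>2) = x powr (1 - \<nu>) * lommel_t (\<mu> - 1) (\<nu> - 1) x"
      unfolding lommel_t_eq_lower[OF x] gamma_quotient_series_commute[of B] by (simp only: mult_ac)
  qed (use x in auto)
qed

text \<open>
  \<open>G\<close> equals \<open>(x powr \<nu> K\<^sub>\<nu>) (x powr (1-\<nu>) t\<^bsub>\<mu>-1,\<nu>-1\<^esub>) + (x powr (1-\<nu>) K\<^bsub>\<nu>-1\<^esub>) (x powr \<nu> t\<^bsub>\<mu>,\<nu>\<^esub>)\<close>,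
  a sum of products to which the four recurrences apply directly. The homogeneous contributions cancel
  in pairs, and only the inhomogeneity of the Lommel recurrence survives.
\<close>

lemma DERIV_lommel_G:
  assumes x: "x > 0"
  shows "(lommel_G \<mu> \<nu> has_real_derivative x powr \<mu> * bessel_K \<nu> x / (2 powr (\<mu> - 1) * Gamma A * Gamma B)) (at x)"
proof -
  let ?S = "lommel_t (\<mu> - 1) (\<nu> - 1)" and ?T = "lommel_t \<mu> \<nu>"
  have K1: "((\<lambda>x. x powr \<nu> * bessel_K \<nu> x) has_real_derivative - (x powr \<nu> * bessel_K (\<nu> - 1) x)) (at x)"
    by (rule DERIV_powr_bessel_K[OF x])
  \<comment> \<open>The recurrence of order \<open>1 - \<nu>\<close>, rewritten by the symmetry of \<open>K\<close> in its order.\<close>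
  have K2: "((\<lambda>x. x powr (1 - \<nu>) * bessel_K (\<nu> - 1) x) has_real_derivative - (x powr (1 - \<nu>) * bessel_K \<nu> x)) (at x)"
    using DERIV_powr_bessel_K[OF x, of "1 - \<nu>"] bessel_K_uminus[of "\<nu> - 1"] bessel_K_uminus[of \<nu>] by simp
  let ?H = "\<lambda>x. (x powr \<nu> * bessel_K \<nu> x) * (x powr (1 - \<nu>) * ?S x) + (x powr (1 - \<nu>) * bessel_K (\<nu> - 1) x) * (x powr \<nu> * ?T x)"
  have pw: "x powr \<nu> * x powr (1 - \<nu>) = x" if "x > 0" for x :: real
    using that by (simp add: powr_add[symmetric])
  have "(?H has_real_derivative
      (- (x powr \<nu> * bessel_K (\<nu> - 1) x) * (x powr (1 - \<nu>) * ?S x)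
        + x powr (1 - \<nu>) * (?T x + (x / 2) powr (\<mu> - 1) / (Gamma A * Gamma B)) * (x powr \<nu> * bessel_K \<nu> x))
      + (- (x powr (1 - \<nu>) * bessel_K \<nu> x) * (x powr \<nu> * ?T x)
        + (x powr \<nu> * ?S x) * (x powr (1 - \<nu>) * bessel_K (\<nu> - 1) x))) (at x)"
    by (intro DERIV_add DERIV_mult K1 K2 DERIV_powr_lommel_t_upper DERIV_powr_lommel_t_lower x)
  also have "(- (x powr \<nu> * bessel_K (\<nu> - 1) x) * (x powr (1 - \<nu>) * ?S x)
        + x powr (1 - \<nu>) * (?T x + (x / 2) powr (\<mu> - 1) / (Gamma A * Gamma B)) * (x powr \<nu> * bessel_K \<nu> x))
      + (- (x powr (1 - \<nu>) * bessel_K \<nu> x) * (x powr \<nu> * ?T x)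
        + (x powr \<nu> * ?S x) * (x powr (1 - \<nu>) * bessel_K (\<nu> - 1) x))
     = (x powr \<nu> * x powr (1 - \<nu>)) * (bessel_K \<nu> x * ((x / 2) powr (\<mu> - 1) / (Gamma A * Gamma B)))"
    by (simp only: ring_distribs mult_minus_left mult_ac) simp
  also have "\<dots> = x powr \<mu> * bessel_K \<nu> x / (2 powr (\<mu> - 1) * Gamma A * Gamma B)"
  proof -
    have "x * (x / 2) powr (\<mu> - 1) = x powr \<mu> / 2 powr (\<mu> - 1)"
      using x by (simp add: powr_divide powr_diff)
    moreover have "x * (bessel_K \<nu> x * ((x / 2) powr (\<mu> - 1) / (Gamma A * Gamma B)))
        = (x * (x / 2) powr (\<mu> - 1)) * bessel_K \<nu> x / (Gamma A * Gamma B)"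
      by (simp only: times_divide_eq_right mult_ac)
    ultimately show ?thesis
      unfolding pw[OF x] by (simp add: mult_ac)
  qed
  finally show ?thesis
  proof (rule has_field_derivative_transform_within_open[where S = "{0<..}"])
    fix x :: real assume "x \<in> {0<..}"
    then have x: "x > 0" by simp
    have "?H x = (x powr \<nu> * x powr (1 - \<nu>)) * (bessel_K \<nu> x * ?S x + bessel_K (\<nu> - 1) x * ?T x)"
      by (simp only: ring_distribs mult_ac)
    then show "?H x = lommel_G \<mu> \<nu> x"
      using x unfolding pw[OF x] by (simp add: lommel_G_def)
  qed (use x in auto)
qed

text \<open>
  The exponent \<open>a\<close> is chosen strictly between \<open>\<bar>\<nu>\<bar>\<close> and \<open>\<mu> + 1\<close>. Then \<open>x powr a * K\<^sub>\<nu>\<close> and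
  \<open>x powr (a + 1) * K\<^bsub>\<nu>-1\<^esub>\<close> are bounded, and the factor \<open>x powr (1 + \<mu> - a)\<close> left over in both terms
  of \<open>G\<close> tends to \<open>0\<close>.
\<close>

lemma lommel_G_tendsto_0: "(lommel_G \<mu> \<nu> \<longlongrightarrow> 0) (at_right 0)"
proof -
  \<comment> \<open>The midpoint of \<open>\<bar>\<nu>\<bar>\<close> and \<open>\<mu> + 1\<close>.\<close>
  define a where "a = (\<bar>\<nu>\<bar> + \<mu> + 1) / 2"
  have a: "\<bar>\<nu>\<bar> \<le> a" "\<bar>\<nu> - 1\<bar> \<le> a + 1" "a > 0" "1 + \<mu> - a > 0"
  proof -
    show "\<bar>\<nu>\<bar> \<le> a" "1 + \<mu> - a > 0" using index by (auto simp: a_def)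
    show "a > 0" using index abs_ge_zero[of \<nu>] by (simp add: a_def)
    then show "\<bar>\<nu> - 1\<bar> \<le> a + 1" using \<open>\<bar>\<nu>\<bar> \<le> a\<close> by linarith
  qed
  define c d where "c = 2 powr (- \<mu>) * (2 powr (a - 1) * Gamma a)"
    and "d = 2 powr (- \<mu> - 1) * (2 powr a * Gamma (a + 1))"
  let ?P = "gamma_quotient_series (A + 1) B" and ?Q = "gamma_quotient_series (A + 1) (B + 1)"
  let ?bound = "\<lambda>x. x powr (1 + \<mu> - a) * (c * ?P ((x / 2)\<^sup>2) + d * ?Q ((x / 2)\<^sup>2))"
  have sq: "((\<lambda>x. (x / 2)\<^sup>2) \<longlongrightarrow> 0) (at_right (0::real))"
    by (auto intro!: tendsto_eq_intros)
  have "((\<lambda>x. x powr (1 + \<mu> - a)) \<longlongrightarrow> 0) (at_right 0)"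
    using a by (intro tendsto_eq_intros) (auto simp: eventually_at_right_less intro!: eventually_mono[OF eventually_at_right_less])
  then have "(?bound \<longlongrightarrow> 0 * (c * ?P 0 + d * ?Q 0)) (at_right 0)"
    using AB_pos by (intro tendsto_intros isCont_tendsto_compose[OF isCont_gamma_quotient_series] sq) auto
  then have lim: "(?bound \<longlongrightarrow> 0) (at_right 0)" by simp
  have "norm (lommel_G \<mu> \<nu> x) \<le> ?bound x" if x: "x > 0" for x
  proof -
    have P: "0 \<le> ?P ((x / 2)\<^sup>2)" and Q: "0 \<le> ?Q ((x / 2)\<^sup>2)"
      using AB_pos by (auto intro!: gamma_quotient_series_nonneg)
    have pw: "x * (x / 2) powr m = x powr (1 + m - b) * 2 powr (- m) * x powr b" for m b
    proof -
      have 1: "x powr (1 + m - b) * x powr b = x * x powr m"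
        using x by (simp add: powr_add[symmetric] powr_mult_base)
      have 2: "(x / 2) powr m = x powr m * 2 powr (- m)"
        using x by (simp add: powr_divide powr_minus_divide)
      have "x powr (1 + m - b) * 2 powr (- m) * x powr b = (x powr (1 + m - b) * x powr b) * 2 powr (- m)"
        by (simp only: mult_ac)
      then show ?thesis unfolding 1 2 by (simp only: mult_ac)
    qed
    have e1: "x * (bessel_K \<nu> x * lommel_t (\<mu> - 1) (\<nu> - 1) x)
        = x powr (1 + \<mu> - a) * (2 powr (- \<mu>) * (x powr a * bessel_K \<nu> x) * ?P ((x / 2)\<^sup>2))"
    proof -
      have "x * (x / 2) powr \<mu> = x powr (1 + \<mu> - a) * 2 powr (- \<mu>) * x powr a"
        using pw[of \<mu> a] .
      then have "(x * (x / 2) powr \<mu>) * (bessel_K \<nu> x * ?P ((x / 2)\<^sup>2))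
          = (x powr (1 + \<mu> - a) * 2 powr (- \<mu>) * x powr a) * (bessel_K \<nu> x * ?P ((x / 2)\<^sup>2))" by (rule arg_cong)
      then show ?thesis unfolding lommel_t_eq_lower[OF x] by (simp only: mult_ac)
    qed
    have e2: "x * (bessel_K (\<nu> - 1) x * lommel_t \<mu> \<nu> x)
        = x powr (1 + \<mu> - a) * (2 powr (- \<mu> - 1) * (x powr (a + 1) * bessel_K (\<nu> - 1) x) * ?Q ((x / 2)\<^sup>2))"
    proof -
      have "x * (x / 2) powr (\<mu> + 1) = x powr (1 + \<mu> - a) * 2 powr (- \<mu> - 1) * x powr (a + 1)"
      proof -
        have eq: "1 + (\<mu> + 1) - (a + 1) = 1 + \<mu> - a" "- (\<mu> + 1) = - \<mu> - 1" by simp_all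
        show ?thesis using pw[of "\<mu> + 1" "a + 1"] unfolding eq .
      qed
      then have "(x * (x / 2) powr (\<mu> + 1)) * (bessel_K (\<nu> - 1) x * ?Q ((x / 2)\<^sup>2))
          = (x powr (1 + \<mu> - a) * 2 powr (- \<mu> - 1) * x powr (a + 1)) * (bessel_K (\<nu> - 1) x * ?Q ((x / 2)\<^sup>2))" by (rule arg_cong)
      then show ?thesis unfolding lommel_t_eq_upper[OF x] by (simp only: mult_ac)
    qed
    have "lommel_G \<mu> \<nu> x = x powr (1 + \<mu> - a) * (2 powr (- \<mu>) * (x powr a * bessel_K \<nu> x) * ?P ((x / 2)\<^sup>2)
       + 2 powr (- \<mu> - 1) * (x powr (a + 1) * bessel_K (\<nu> - 1) x) * ?Q ((x / 2)\<^sup>2))"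
      using x by (simp add: lommel_G_def distrib_left e1 e2)
    moreover have "0 \<le> 2 powr (- \<mu>) * (x powr a * bessel_K \<nu> x) * ?P ((x / 2)\<^sup>2)"
      "0 \<le> 2 powr (- \<mu> - 1) * (x powr (a + 1) * bessel_K (\<nu> - 1) x) * ?Q ((x / 2)\<^sup>2)"
      using P Q by (auto intro!: mult_nonneg_nonneg bessel_K_nonneg)
    moreover have "2 powr (- \<mu>) * (x powr a * bessel_K \<nu> x) * ?P ((x / 2)\<^sup>2) \<le> c * ?P ((x / 2)\<^sup>2)"
      unfolding c_def by (intro mult_right_mono mult_left_mono P powr_bessel_K_le_Gamma x a) simp
    moreover have "2 powr (- \<mu> - 1) * (x powr (a + 1) * bessel_K (\<nu> - 1) x) * ?Q ((x / 2)\<^sup>2) \<le> d * ?Q ((x / 2)\<^sup>2)"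
      unfolding d_def using powr_bessel_K_le_Gamma[OF x, of "\<nu> - 1" "a + 1"] a
      by (intro mult_right_mono mult_left_mono Q) auto
    ultimately show ?thesis
      by (simp add: abs_mult mult_left_mono)
  qed
  then show ?thesis
    by (intro Lim_null_comparison[OF _ lim]) (auto simp: eventually_at_right_less intro!: eventually_mono[OF eventually_at_right_less])
qed

end

text \<open>
  By the fundamental theorem of calculus, \<open>G\<close> is the fraction of the Mellin integral that lies in
  \<open>{0<..x}\<close>; the complementary function is the remaining fraction.
\<close>

lemma integral_powr_bessel_K_tail:
  fixes \<mu> \<nu> A B x :: real
  assumes index: "\<bar>\<nu>\<bar> < \<mu> + 1" and x: "0 \<le> x"
  defines "A \<equiv> (\<mu> - \<nu> + 1) / 2" and "B \<equiv> (\<mu> + \<nu> + 1) / 2"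
  shows "set_integrable lborel {x<..} (\<lambda>y. y powr \<mu> * bessel_K \<nu> y)"
    "(LBINT y:{x<..}. y powr \<mu> * bessel_K \<nu> y) = 2 powr (\<mu> - 1) * Gamma A * Gamma B * lommel_G_tilde \<mu> \<nu> x"
proof -
  let ?f = "\<lambda>y. y powr \<mu> * bessel_K \<nu> y"
  have pos: "A > 0" "B > 0"
    using index by (auto simp: A_def B_def abs_if split: if_splits)
  define m where "m = 2 powr (\<mu> - 1) * Gamma A * Gamma B"
  have m: "m > 0" unfolding m_def using pos by (intro mult_pos_pos Gamma_real_pos) auto
  have "(\<integral>\<^sup>+y. ennreal (indicator {0<..} y *\<^sub>R ?f y) \<partial>lborel) = (\<integral>\<^sup>+y\<in>{0<..}. ennreal (?f y) \<partial>lborel)"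
    by (intro nn_integral_cong) (simp split: split_indicator)
  also have "\<dots> = ennreal m"
    unfolding m_def A_def B_def by (rule nn_integral_powr_bessel_K[OF index])
  finally have "has_bochner_integral lborel (\<lambda>y. indicator {0<..} y *\<^sub>R ?f y) m"
    using m by (intro has_bochner_integral_nn_integral) (auto simp: bessel_K_nonneg)
  then have int: "set_integrable lborel {0<..} ?f" and total: "(LBINT y:{0<..}. ?f y) = m"
    by (simp_all add: has_bochner_integral_iff set_integrable_def set_lebesgue_integral_def)
  show int_x: "set_integrable lborel {x<..} ?f"
    using x by (auto intro: set_integrable_subset[OF int])
  show "(LBINT y:{x<..}. ?f y) = 2 powr (\<mu> - 1) * Gamma A * Gamma B * lommel_G_tilde \<mu> \<nu> x"
    unfolding m_def[symmetric]
  proof (cases "x = 0")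
    case True
    then show "(LBINT y:{x<..}. ?f y) = m * lommel_G_tilde \<mu> \<nu> x"
      using total by (simp add: lommel_G_tilde_def lommel_G_def)
  next
    case False
    then have x: "x > 0" using x by simp
    have "(LBINT y=0..x. ?f y) = m * lommel_G \<mu> \<nu> x - 0"
    proof (rule interval_integral_FTC_nonneg)
      show "(0::ereal) < ereal x" using x by simp
      show "((\<lambda>x. m * lommel_G \<mu> \<nu> x) has_real_derivative ?f y) (at y)" if "(0::ereal) < ereal y" for y
      proof -
        have "(lommel_G \<mu> \<nu> has_real_derivative ?f y / m) (at y)"
          using DERIV_lommel_G[OF index, of y] that unfolding m_def A_def B_def by simp
        from DERIV_cmult[OF this, of m] show ?thesis using m by simp
      qed
      show "isCont ?f y" if "(0::ereal) < ereal y" for y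
        using that by (intro continuous_intros isCont_bessel_K) auto
      show "AE y in lborel. (0::ereal) < ereal y \<longrightarrow> ereal y < ereal x \<longrightarrow> 0 \<le> ?f y"
        by (simp add: bessel_K_nonneg)
      have "((\<lambda>x. m * lommel_G \<mu> \<nu> x) \<longlongrightarrow> m * 0) (at_right 0)"
        by (intro tendsto_intros lommel_G_tendsto_0 index)
      then show "(((\<lambda>x. m * lommel_G \<mu> \<nu> x) \<circ> real_of_ereal) \<longlongrightarrow> 0) (at_right 0)"
        by (simp add: zero_ereal_def ereal_tendsto_simps)
      have "isCont (lommel_G \<mu> \<nu>) x"
        by (rule DERIV_isCont[OF DERIV_lommel_G[OF index x]])
      then have "((\<lambda>x. m * lommel_G \<mu> \<nu> x) \<longlongrightarrow> m * lommel_G \<mu> \<nu> x) (at_left x)"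
        by (intro tendsto_intros) (simp add: isCont_def filterlim_at_split)
      then show "(((\<lambda>x. m * lommel_G \<mu> \<nu> x) \<circ> real_of_ereal) \<longlongrightarrow> m * lommel_G \<mu> \<nu> x) (at_left (ereal x))"
        by (simp add: ereal_tendsto_simps)
    qed
    also have "(LBINT y=0..x. ?f y) = (LBINT y:{0<..x}. ?f y)"
      using x by (simp add: interval_integral_Ioc zero_ereal_def)
    finally have initial: "(LBINT y:{0<..x}. ?f y) = m * lommel_G \<mu> \<nu> x" by simp
    have "m = (LBINT y:{0<..x} \<union> {x<..}. ?f y)"
      unfolding total[symmetric] using x by (intro arg_cong2[where f = "set_lebesgue_integral lborel"]) auto
    also have "\<dots> = (LBINT y:{0<..x}. ?f y) + (LBINT y:{x<..}. ?f y)"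
      using int_x x by (intro set_integral_Un set_integrable_subset[OF int]) auto
    finally show "(LBINT y:{x<..}. ?f y) = m * lommel_G_tilde \<mu> \<nu> x"
      unfolding initial by (simp add: lommel_G_tilde_def algebra_simps)
  qed
qed

section \<open>Variance-gamma densities\<close>

definition gamma_density :: "real \<Rightarrow> real \<Rightarrow> real" where
  "gamma_density \<alpha> w = (if 0 < w then w powr (\<alpha> - 1) * exp (- w) / Gamma \<alpha> else 0)"

text \<open>
  The density of a centred normal variable with random variance \<open>2 W\<close>, where \<open>W\<close> is gamma distributed
  with shape \<open>\<alpha>\<close>. For \<open>\<alpha> \<le> 1 / 2\<close> it is infinite at \<open>y = 0\<close>, hence the values in the extended reals.
\<close>

definition variance_gamma_density :: "real \<Rightarrow> real \<Rightarrow> ennreal" where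
  "variance_gamma_density \<alpha> y =
     (\<integral>\<^sup>+w. ennreal (gamma_density \<alpha> w) * ennreal (normal_density 0 (sqrt (2 * w)) y) \<partial>lborel)"

lemma borel_measurable_gamma_density [measurable]: "gamma_density \<alpha> \<in> borel_measurable borel"
  unfolding gamma_density_def[abs_def] by measurable

lemma gamma_density_nonneg: "\<alpha> > 0 \<Longrightarrow> 0 \<le> gamma_density \<alpha> w"
  by (simp add: gamma_density_def Gamma_real_pos less_imp_le)

lemma borel_measurable_normal_density_variance [measurable]:
  assumes [measurable]: "f \<in> borel_measurable M" "g \<in> borel_measurable M"
  shows "(\<lambda>x. normal_density 0 (f x) (g x)) \<in> borel_measurable M"
  unfolding normal_density_def by measurable

lemma borel_measurable_variance_gamma_density [measurable]:
  "variance_gamma_density \<alpha> \<in> borel_measurable borel"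
  unfolding variance_gamma_density_def[abs_def] by measurable

text \<open>
  Rescaling \<open>u = t v\<close> turns the convolution into Euler's Beta integral.
\<close>

lemma nn_integral_gamma_density_convolution:
  assumes a: "\<alpha> > 0" and b: "\<beta> > 0"
  shows "(\<integral>\<^sup>+u. ennreal (gamma_density \<alpha> (t - u)) * ennreal (gamma_density \<beta> u) \<partial>lborel) = ennreal (gamma_density (\<alpha> + \<beta>) t)"
proof (cases "t > 0")
  case False
  have "(\<integral>\<^sup>+u. ennreal (gamma_density \<alpha> (t - u)) * ennreal (gamma_density \<beta> u) \<partial>lborel) = (\<integral>\<^sup>+u. 0 \<partial>(lborel :: real measure))"
    using False by (intro nn_integral_cong) (auto simp: gamma_density_def)
  then show ?thesis using False by (simp add: gamma_density_def)
next
  case t: True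
  have G: "Gamma \<alpha> > 0" "Gamma \<beta> > 0" "Gamma (\<alpha> + \<beta>) > 0"
    using a b by (auto intro!: Gamma_real_pos)
  let ?C = "t powr (\<alpha> + \<beta> - 2) * exp (- t) / (Gamma \<alpha> * Gamma \<beta>)"
  let ?b = "\<lambda>v::real. indicator {0..1} v * (v powr (\<beta> - 1) * (1 - v) powr (\<alpha> - 1))"
  have "(\<integral>\<^sup>+u. ennreal (gamma_density \<alpha> (t - u)) * ennreal (gamma_density \<beta> u) \<partial>lborel)
    = ennreal \<bar>t\<bar> * (\<integral>\<^sup>+v. ennreal (gamma_density \<alpha> (t - (0 + t * v))) * ennreal (gamma_density \<beta> (0 + t * v)) \<partial>lborel)"
    using t by (intro nn_integral_real_affine) auto
  also have "(\<integral>\<^sup>+v. ennreal (gamma_density \<alpha> (t - (0 + t * v))) * ennreal (gamma_density \<beta> (0 + t * v)) \<partial>lborel)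
    = (\<integral>\<^sup>+v. ennreal ?C * ennreal (?b v) \<partial>lborel)"
  proof (rule nn_integral_cong)
    fix v :: real
    \<comment> \<open>The endpoints \<open>0\<close> and \<open>1\<close> fit in because \<open>0 powr x = 0\<close>, even for \<open>x \<le> 0\<close>.\<close>
    consider "v \<le> 0" | "v \<ge> 1" | "0 < v" "v < 1" by linarith
    then show "ennreal (gamma_density \<alpha> (t - (0 + t * v))) * ennreal (gamma_density \<beta> (0 + t * v)) = ennreal ?C * ennreal (?b v)"
    proof cases
      case 1
      then have "t * v \<le> 0" using t by (simp add: mult_nonneg_nonpos)
      then show ?thesis using 1 by (cases "v = 0") (simp_all add: gamma_density_def)
    next
      case 2
      then have "t * 1 \<le> t * v" using t by (intro mult_left_mono) auto
      then show ?thesis using 2 by (cases "v = 1") (simp_all add: gamma_density_def)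
    next
      case 3
      have "t - (0 + t * v) = t * (1 - v)" by (simp add: algebra_simps)
      moreover have "t * (1 - v) > 0" "t * v > 0" using t 3 by simp_all
      moreover have "(t * (1 - v)) powr (\<alpha> - 1) = t powr (\<alpha> - 1) * (1 - v) powr (\<alpha> - 1)"
        "(t * v) powr (\<beta> - 1) = t powr (\<beta> - 1) * v powr (\<beta> - 1)"
        using t 3 by (simp_all add: powr_mult)
      ultimately have 1: "gamma_density \<alpha> (t - (0 + t * v)) = t powr (\<alpha> - 1) * (1 - v) powr (\<alpha> - 1) * exp (- (t * (1 - v))) / Gamma \<alpha>"
        "gamma_density \<beta> (0 + t * v) = t powr (\<beta> - 1) * v powr (\<beta> - 1) * exp (- (t * v)) / Gamma \<beta>"
        by (simp_all add: gamma_density_def)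
      have "t powr (\<alpha> - 1) * t powr (\<beta> - 1) = t powr (\<alpha> + \<beta> - 2)"
        by (simp add: powr_add[symmetric])
      moreover have "exp (- (t * (1 - v))) * exp (- (t * v)) = exp (- t)"
        by (simp add: exp_add[symmetric] algebra_simps)
      moreover have "gamma_density \<alpha> (t - (0 + t * v)) * gamma_density \<beta> (0 + t * v)
        = (t powr (\<alpha> - 1) * t powr (\<beta> - 1)) * (exp (- (t * (1 - v))) * exp (- (t * v))) / (Gamma \<alpha> * Gamma \<beta>) * (v powr (\<beta> - 1) * (1 - v) powr (\<alpha> - 1))"
        unfolding 1 by (simp only: times_divide_eq_left times_divide_eq_right divide_divide_eq_left mult_ac)
      ultimately have "gamma_density \<alpha> (t - (0 + t * v)) * gamma_density \<beta> (0 + t * v) = ?C * ?b v"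
        using 3 by simp
      then show ?thesis
        using a b by (subst (1 2) ennreal_mult'[symmetric]) (auto simp: gamma_density_nonneg)
    qed
  qed
  also have "\<dots> = ennreal ?C * ennreal (Beta \<beta> \<alpha>)"
  proof -
    have "(\<integral>\<^sup>+v. ennreal (?b v) \<partial>lborel) = ennreal (Beta \<beta> \<alpha>)"
      by (rule nn_integral_has_integral_lebesgue[OF _ has_integral_Beta_real[OF b a]]) simp
    then show ?thesis by (subst nn_integral_cmult) auto
  qed
  also have "ennreal \<bar>t\<bar> * \<dots> = ennreal (gamma_density (\<alpha> + \<beta>) t)"
  proof -
    have "t * (?C * Beta \<beta> \<alpha>) = gamma_density (\<alpha> + \<beta>) t"
    proof -
      have "t * t powr (\<alpha> + \<beta> - 2) = t powr (\<alpha> + \<beta> - 1)"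
        using t by (simp add: powr_mult_base)
      then have "t * (t powr (\<alpha> + \<beta> - 2) * exp (- t) / (Gamma \<alpha> * Gamma \<beta>) * (Gamma \<beta> * Gamma \<alpha> / Gamma (\<beta> + \<alpha>)))
          = t powr (\<alpha> + \<beta> - 1) * exp (- t) / Gamma (\<alpha> + \<beta>)"
        using G by (simp add: mult.assoc[symmetric] add.commute)
      then show ?thesis using t by (simp add: gamma_density_def Beta_def)
    qed
    moreover have "0 \<le> ?C" "0 \<le> Beta \<beta> \<alpha>" using G by (simp_all add: Beta_def add.commute)
    ultimately show ?thesis using t by (simp only: ennreal_mult[symmetric] abs_of_pos mult_nonneg_nonneg less_imp_le)
  qed
  finally show ?thesis .
qed

lemma nn_integral_normal_density_convolution:
  assumes "w > 0" "w' > 0"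
  shows "(\<integral>\<^sup>+u. ennreal (normal_density 0 (sqrt (2 * w)) (y - u)) * ennreal (normal_density 0 (sqrt (2 * w')) u) \<partial>lborel)
    = ennreal (normal_density 0 (sqrt (2 * (w + w'))) y)"
proof -
  have "(\<integral>\<^sup>+u. ennreal (normal_density 0 (sqrt (2 * w)) (y - u) * normal_density 0 (sqrt (2 * w')) u) \<partial>lborel)
      = ennreal (normal_density 0 (sqrt ((sqrt (2 * w))\<^sup>2 + (sqrt (2 * w'))\<^sup>2)) y)"
    using fun_cong[OF conv_normal_density_zero_mean[of "sqrt (2 * w)" "sqrt (2 * w')"], of y] assms by simp
  moreover have "(sqrt (2 * w))\<^sup>2 + (sqrt (2 * w'))\<^sup>2 = 2 * (w + w')" using assms by simp
  ultimately show ?thesis by (simp add: ennreal_mult'[symmetric])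
qed

text \<open>
  By Tonelli's theorem the normal densities are convolved first, for fixed variances \<open>2 w\<close> and \<open>2 w'\<close>. The result
  depends on \<open>w + w'\<close> only, so what remains is the convolution of the gamma densities.
\<close>

lemma variance_gamma_density_convolution:
  assumes a: "\<alpha> > 0" and b: "\<beta> > 0"
  shows "(\<integral>\<^sup>+u. variance_gamma_density \<alpha> (y - u) * variance_gamma_density \<beta> u \<partial>lborel) = variance_gamma_density (\<alpha> + \<beta>) y"
proof -
  let ?g = "\<lambda>\<alpha> w. ennreal (gamma_density \<alpha> w)" and ?n = "\<lambda>w y. ennreal (normal_density 0 (sqrt (2 * w)) y)"
  have "(\<integral>\<^sup>+u. variance_gamma_density \<alpha> (y - u) * variance_gamma_density \<beta> u \<partial>lborel)
      = (\<integral>\<^sup>+u. (\<integral>\<^sup>+w. (\<integral>\<^sup>+w'. ?g \<alpha> w * ?n w (y - u) * (?g \<beta> w' * ?n w' u) \<partial>lborel) \<partial>lborel) \<partial>lborel)"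
  proof (rule nn_integral_cong)
    fix u :: real
    have "variance_gamma_density \<alpha> (y - u) * variance_gamma_density \<beta> u
        = (\<integral>\<^sup>+w. ?g \<alpha> w * ?n w (y - u) * variance_gamma_density \<beta> u \<partial>lborel)"
      unfolding variance_gamma_density_def[of \<alpha>] by (rule nn_integral_multc[symmetric]) measurable
    also have "\<dots> = (\<integral>\<^sup>+w. (\<integral>\<^sup>+w'. ?g \<alpha> w * ?n w (y - u) * (?g \<beta> w' * ?n w' u) \<partial>lborel) \<partial>lborel)"
      unfolding variance_gamma_density_def
      by (rule nn_integral_cong, rule nn_integral_cmult[symmetric]) measurable
    finally show "variance_gamma_density \<alpha> (y - u) * variance_gamma_density \<beta> u = \<dots>" .
  qed
  also have "\<dots> = (\<integral>\<^sup>+w. (\<integral>\<^sup>+u. (\<integral>\<^sup>+w'. ?g \<alpha> w * ?n w (y - u) * (?g \<beta> w' * ?n w' u) \<partial>lborel) \<partial>lborel) \<partial>lborel)"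
    by (rule nn_integral_swap_lborel) measurable
  also have "\<dots> = (\<integral>\<^sup>+w. (\<integral>\<^sup>+w'. (\<integral>\<^sup>+u. ?g \<alpha> w * ?n w (y - u) * (?g \<beta> w' * ?n w' u) \<partial>lborel) \<partial>lborel) \<partial>lborel)"
    by (rule nn_integral_cong, rule nn_integral_swap_lborel) measurable
  also have "\<dots> = (\<integral>\<^sup>+w. (\<integral>\<^sup>+w'. ?g \<alpha> w * ?g \<beta> w' * ?n (w + w') y \<partial>lborel) \<partial>lborel)"
  proof (intro nn_integral_cong)
    fix w w' :: real
    show "(\<integral>\<^sup>+u. ?g \<alpha> w * ?n w (y - u) * (?g \<beta> w' * ?n w' u) \<partial>lborel) = ?g \<alpha> w * ?g \<beta> w' * ?n (w + w') y"
    proof (cases "w > 0 \<and> w' > 0")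
      case True
      have "(\<integral>\<^sup>+u. ?g \<alpha> w * ?n w (y - u) * (?g \<beta> w' * ?n w' u) \<partial>lborel)
          = (\<integral>\<^sup>+u. (?g \<alpha> w * ?g \<beta> w') * (?n w (y - u) * ?n w' u) \<partial>lborel)"
        by (simp only: mult_ac)
      also have "\<dots> = (?g \<alpha> w * ?g \<beta> w') * (\<integral>\<^sup>+u. ?n w (y - u) * ?n w' u \<partial>lborel)"
        by (rule nn_integral_cmult) measurable
      finally show ?thesis
        using True by (simp only: nn_integral_normal_density_convolution)
    next
      case False
      then have "?g \<alpha> w = 0 \<or> ?g \<beta> w' = 0" by (auto simp: gamma_density_def)
      then show ?thesis by auto
    qed
  qed
  also have "\<dots> = (\<integral>\<^sup>+w'. (\<integral>\<^sup>+w. ?g \<alpha> w * ?g \<beta> w' * ?n (w + w') y \<partial>lborel) \<partial>lborel)"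
    by (rule nn_integral_swap_lborel) measurable
  also have "\<dots> = (\<integral>\<^sup>+w'. (\<integral>\<^sup>+t. ?g \<alpha> (t - w') * ?g \<beta> w' * ?n t y \<partial>lborel) \<partial>lborel)"
  proof (rule nn_integral_cong)
    fix w' :: real
    define F where "F w = ?g \<alpha> w * ?g \<beta> w' * ?n (w + w') y" for w
    have [measurable]: "F \<in> borel_measurable borel" unfolding F_def[abs_def] by measurable
    have "(\<integral>\<^sup>+w. F w \<partial>lborel) = ennreal \<bar>1\<bar> * (\<integral>\<^sup>+t. F (- w' + 1 * t) \<partial>lborel)"
      by (rule nn_integral_real_affine) simp_all
    also have "\<dots> = (\<integral>\<^sup>+t. F (t - w') \<partial>lborel)" by simp
    finally show "(\<integral>\<^sup>+w. ?g \<alpha> w * ?g \<beta> w' * ?n (w + w') y \<partial>lborel) = (\<integral>\<^sup>+t. ?g \<alpha> (t - w') * ?g \<beta> w' * ?n t y \<partial>lborel)"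
      unfolding F_def by (simp only: diff_add_cancel)
  qed
  also have "\<dots> = (\<integral>\<^sup>+t. (\<integral>\<^sup>+w'. ?g \<alpha> (t - w') * ?g \<beta> w' * ?n t y \<partial>lborel) \<partial>lborel)"
    by (rule nn_integral_swap_lborel) measurable
  also have "\<dots> = (\<integral>\<^sup>+t. (\<integral>\<^sup>+w'. ?g \<alpha> (t - w') * ?g \<beta> w' \<partial>lborel) * ?n t y \<partial>lborel)"
    by (rule nn_integral_cong, rule nn_integral_multc) measurable
  also have "\<dots> = variance_gamma_density (\<alpha> + \<beta>) y"
    unfolding variance_gamma_density_def nn_integral_gamma_density_convolution[OF a b] ..
  finally show ?thesis .
qed

lemma variance_gamma_density_eq:
  assumes "\<alpha> > 0"
  shows "variance_gamma_density \<alpha> y = ennreal (1 / (2 * sqrt pi * Gamma \<alpha>)) *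
    (\<integral>\<^sup>+w\<in>{0<..}. ennreal (w powr (\<alpha> - 1 / 2 - 1) * exp (- w - y\<^sup>2 / (4 * w))) \<partial>lborel)"
proof -
  have "Gamma \<alpha> > 0" using assms by (rule Gamma_real_pos)
  have "variance_gamma_density \<alpha> y = (\<integral>\<^sup>+w. ennreal (1 / (2 * sqrt pi * Gamma \<alpha>)) *
    (ennreal (w powr (\<alpha> - 1 / 2 - 1) * exp (- w - y\<^sup>2 / (4 * w))) * indicator {0<..} w) \<partial>lborel)"
    unfolding variance_gamma_density_def
  proof (rule nn_integral_cong)
    fix w :: real
    show "ennreal (gamma_density \<alpha> w) * ennreal (normal_density 0 (sqrt (2 * w)) y) = ennreal (1 / (2 * sqrt pi * Gamma \<alpha>)) *
      (ennreal (w powr (\<alpha> - 1 / 2 - 1) * exp (- w - y\<^sup>2 / (4 * w))) * indicator {0<..} w)"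
    proof (cases "w > 0")
      case True
      have "sqrt (2 * pi * (sqrt (2 * w))\<^sup>2) = 2 * sqrt pi * sqrt w"
      proof -
        have "2 * pi * (sqrt (2 * w))\<^sup>2 = 4 * (pi * w)" using True by simp
        then show ?thesis by (simp add: real_sqrt_mult)
      qed
      moreover have "- (y - 0)\<^sup>2 / (2 * (sqrt (2 * w))\<^sup>2) = - y\<^sup>2 / (4 * w)" using True by simp
      ultimately have n: "normal_density 0 (sqrt (2 * w)) y = 1 / (2 * sqrt pi * sqrt w) * exp (- y\<^sup>2 / (4 * w))"
        unfolding normal_density_def by (simp only:)
      have g: "gamma_density \<alpha> w = w powr (\<alpha> - 1) * exp (- w) / Gamma \<alpha>" using True by (simp add: gamma_density_def)
      have p: "w powr (\<alpha> - 1 / 2 - 1) = w powr (\<alpha> - 1) / sqrt w"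
      proof -
        have "\<alpha> - 1 / 2 - 1 = (\<alpha> - 1) - 1 / 2" by simp
        then show ?thesis using True by (simp only: powr_diff powr_half_sqrt less_imp_le)
      qed
      have e: "exp (- w - y\<^sup>2 / (4 * w)) = exp (- w) * exp (- y\<^sup>2 / (4 * w))" by (simp add: exp_add[symmetric])
      have "gamma_density \<alpha> w * normal_density 0 (sqrt (2 * w)) y
        = 1 / (2 * sqrt pi * Gamma \<alpha>) * (w powr (\<alpha> - 1 / 2 - 1) * exp (- w - y\<^sup>2 / (4 * w)))"
        unfolding n g p e by (simp only: times_divide_eq_left times_divide_eq_right divide_divide_eq_left mult_ac mult_1_left mult_1_right)
      then show ?thesis
        using True \<open>Gamma \<alpha> > 0\<close> by (simp add: ennreal_mult'[symmetric] gamma_density_nonneg assms)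
    qed (simp add: gamma_density_def)
  qed
  also have "\<dots> = ennreal (1 / (2 * sqrt pi * Gamma \<alpha>)) *
    (\<integral>\<^sup>+w\<in>{0<..}. ennreal (w powr (\<alpha> - 1 / 2 - 1) * exp (- w - y\<^sup>2 / (4 * w))) \<partial>lborel)"
    by (rule nn_integral_cmult) measurable
  finally show ?thesis .
qed

section \<open>Products of correlated normal variables\<close>

lemma borel_measurable_bivariate_normal_density [measurable]:
  assumes [measurable]: "f \<in> borel_measurable M" "g \<in> borel_measurable M"
  shows "(\<lambda>x. bivariate_normal_density a b r (f x) (g x)) \<in> borel_measurable M"
  unfolding bivariate_normal_density_def by measurable

text \<open>
  Along the hyperbola \<open>u v = c y\<close> the exponent of the bivariate density is \<open>\<rho> y - w - y\<^sup>2 / (4 w)\<close> with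
  \<open>w = v\<^sup>2 / (2 \<sigma>\<^sub>2\<^sup>2 (1 - \<rho>\<^sup>2))\<close>. The two branches \<open>v > 0\<close> and \<open>v < 0\<close> contribute equally, and \<open>w\<close> as the
  new variable gives the gamma mixture of shape \<open>1 / 2\<close>.
\<close>

lemma nn_integral_bivariate_normal_hyperbola:
  assumes \<sigma>: "\<sigma>\<^sub>1 > 0" "\<sigma>\<^sub>2 > 0" and \<rho>: "\<rho>\<^sup>2 < 1"
  defines "c \<equiv> \<sigma>\<^sub>1 * \<sigma>\<^sub>2 * (1 - \<rho>\<^sup>2)"
  shows "(\<integral>\<^sup>+v. ennreal (\<bar>c / v\<bar> * bivariate_normal_density \<sigma>\<^sub>1 \<sigma>\<^sub>2 \<rho> (c * y / v) v) \<partial>lborel)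
    = ennreal (sqrt (1 - \<rho>\<^sup>2) * exp (\<rho> * y)) * variance_gamma_density (1 / 2) y"
proof -
  define r where "r = 1 - \<rho>\<^sup>2"
  define k where "k = 2 * \<sigma>\<^sub>2\<^sup>2 * r"
  have c_eq: "c = \<sigma>\<^sub>1 * \<sigma>\<^sub>2 * r" by (simp add: c_def r_def)
  have r: "r > 0" using \<rho> by (simp add: r_def)
  have k: "k > 0" using r \<sigma> by (simp add: k_def)
  let ?F = "\<lambda>v. \<bar>c / v\<bar> * bivariate_normal_density \<sigma>\<^sub>1 \<sigma>\<^sub>2 \<rho> (c * y / v) v"
  let ?f = "\<lambda>w. w powr (1 / 2 - 1 / 2 - 1) * exp (- w - y\<^sup>2 / (4 * w))"
  let ?K = "sqrt r * exp (\<rho> * y) / (2 * pi)"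
  have F: "2 * ?F v = ?K * (\<bar>2 * v / k\<bar> * ?f (v\<^sup>2 / k))" if v: "v > 0" for v
  proof -
    have E: "- (1 / (2 * (1 - \<rho>\<^sup>2))) * ((c * y / v)\<^sup>2 / \<sigma>\<^sub>1\<^sup>2 - 2 * \<rho> * (c * y / v) * v / (\<sigma>\<^sub>1 * \<sigma>\<^sub>2) + v\<^sup>2 / \<sigma>\<^sub>2\<^sup>2)
      = \<rho> * y + (- (v\<^sup>2 / k) - y\<^sup>2 / (4 * (v\<^sup>2 / k)))"
    proof -
      have 1: "(c * y / v)\<^sup>2 / \<sigma>\<^sub>1\<^sup>2 = 2 * r * (y\<^sup>2 / (4 * (v\<^sup>2 / k)))"
        using \<sigma> v k by (simp add: c_eq k_def power_mult_distrib power_divide power2_eq_square)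
      have 2: "2 * \<rho> * (c * y / v) * v / (\<sigma>\<^sub>1 * \<sigma>\<^sub>2) = 2 * r * (\<rho> * y)"
        using \<sigma> v by (simp add: c_eq)
      have 3: "v\<^sup>2 / \<sigma>\<^sub>2\<^sup>2 = 2 * r * (v\<^sup>2 / k)"
        using \<sigma> r by (simp add: k_def)
      have 4: "- (1 / (2 * r)) * (2 * r * a - 2 * r * b + 2 * r * d) = b + (- d - a)" for a b d :: real
      proof -
        have "2 * r * a - 2 * r * b + 2 * r * d = (2 * r) * (a - b + d)" by (simp only: ring_distribs)
        then show ?thesis using r by simp
      qed
      show ?thesis unfolding 1 2 3 r_def[symmetric] by (rule 4)
    qed
    have powr: "(v\<^sup>2 / k) powr (1 / 2 - 1 / 2 - 1) = k / v\<^sup>2"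
      using v k by (simp add: powr_minus)
    have coeff: "2 * \<bar>c / v\<bar> * (1 / (2 * pi * \<sigma>\<^sub>1 * \<sigma>\<^sub>2 * sqrt r)) = sqrt r / (2 * pi) * (\<bar>2 * v / k\<bar> * (k / v\<^sup>2))"
    proof -
      have "\<bar>c / v\<bar> = c / v" using \<sigma> v r by (simp add: c_eq)
      then have "2 * \<bar>c / v\<bar> * (1 / (2 * pi * \<sigma>\<^sub>1 * \<sigma>\<^sub>2 * sqrt r)) = (r / sqrt r) / (pi * v)"
        using \<sigma> unfolding c_eq by (simp only: mult_ac) (simp add: mult_ac)
      also have "r / sqrt r = sqrt r" using r by (intro real_div_sqrt) simp
      also have "sqrt r / (pi * v) = sqrt r / (2 * pi) * (\<bar>2 * v / k\<bar> * (k / v\<^sup>2))"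
      proof -
        have "\<bar>2 * v / k\<bar> = 2 * v / k" using v k by simp
        then show ?thesis using v k by (simp add: power2_eq_square)
      qed
      finally show ?thesis .
    qed
    have D: "bivariate_normal_density \<sigma>\<^sub>1 \<sigma>\<^sub>2 \<rho> (c * y / v) v
      = 1 / (2 * pi * \<sigma>\<^sub>1 * \<sigma>\<^sub>2 * sqrt r) * (exp (\<rho> * y) * exp (- (v\<^sup>2 / k) - y\<^sup>2 / (4 * (v\<^sup>2 / k))))"
      unfolding bivariate_normal_density_def by (simp only: E exp_add r_def)
    have "2 * ?F v = (2 * \<bar>c / v\<bar> * (1 / (2 * pi * \<sigma>\<^sub>1 * \<sigma>\<^sub>2 * sqrt r))) * (exp (\<rho> * y) * exp (- (v\<^sup>2 / k) - y\<^sup>2 / (4 * (v\<^sup>2 / k))))"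
      unfolding D by (simp only: mult.assoc)
    also have "\<dots> = ?K * (\<bar>2 * v / k\<bar> * ?f (v\<^sup>2 / k))"
      unfolding coeff powr by (simp only: times_divide_eq_left times_divide_eq_right mult_ac)
    finally show ?thesis .
  qed
  have even: "?F (- v) = ?F v" for v
    by (simp add: bivariate_normal_density_def)
  have [measurable]: "?F \<in> borel_measurable borel" by measurable
  have "(\<integral>\<^sup>+v. ennreal (?F v) \<partial>lborel) = (\<integral>\<^sup>+v\<in>{0..}. (ennreal (?F v) + ennreal (?F (- v))) \<partial>lborel)"
    by (rule nn_integral_reflect) measurable
  also have "\<dots> = (\<integral>\<^sup>+v. ennreal ?K * (ennreal (\<bar>2 * v / k\<bar> * ?f (v\<^sup>2 / k)) * indicator {0<..} v) \<partial>lborel)"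
  proof (rule nn_integral_cong)
    fix v :: real
    have nonneg: "0 \<le> ?F v" using \<sigma> \<rho> by (simp add: bivariate_normal_density_def)
    show "(ennreal (?F v) + ennreal (?F (- v))) * indicator {0..} v
      = ennreal ?K * (ennreal (\<bar>2 * v / k\<bar> * ?f (v\<^sup>2 / k)) * indicator {0<..} v)"
    proof (cases "v > 0")
      case True
      have "ennreal (?F v) + ennreal (?F v) = ennreal (2 * ?F v)"
        using nonneg by (subst ennreal_plus[symmetric]) simp_all
      also have "\<dots> = ennreal ?K * ennreal (\<bar>2 * v / k\<bar> * ?f (v\<^sup>2 / k))"
        unfolding F[OF True] using r by (intro ennreal_mult) auto
      finally show ?thesis using True unfolding even by simp
    next
      case False
      then show ?thesis by (cases "v = 0") simp_all
    qed
  qed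
  also have "\<dots> = ennreal ?K * (\<integral>\<^sup>+v\<in>{0<..}. ennreal (\<bar>2 * v / k\<bar> * ?f (v\<^sup>2 / k)) \<partial>lborel)"
    by (rule nn_integral_cmult) measurable
  also have "(\<integral>\<^sup>+v\<in>{0<..}. ennreal (\<bar>2 * v / k\<bar> * ?f (v\<^sup>2 / k)) \<partial>lborel) = (\<integral>\<^sup>+w\<in>{0<..}. ennreal (?f w) \<partial>lborel)"
    by (rule set_nn_integral_square_substitution[symmetric]) (use k in simp_all)
  also have "ennreal ?K * \<dots> = ennreal (sqrt r * exp (\<rho> * y)) * variance_gamma_density (1 / 2) y"
  proof -
    have "ennreal ?K = ennreal (sqrt r * exp (\<rho> * y)) * ennreal (1 / (2 * sqrt pi * Gamma (1 / 2)))"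
      using r by (simp add: ennreal_mult'[symmetric] Gamma_one_half_real)
    then show ?thesis
      by (subst variance_gamma_density_eq) (simp_all only: mult.assoc zero_less_divide_1_iff zero_less_numeral)
  qed
  finally show ?thesis unfolding r_def .
qed

text \<open>
  For fixed \<open>v \<noteq> 0\<close> the substitution \<open>u = c y / v\<close> makes the product itself the inner variable. Exchanging
  the integrals leaves, for each \<open>y\<close>, the integral along a hyperbola.
\<close>

lemma distributed_product_centred_bivariate_normal:
  assumes \<sigma>: "\<sigma>\<^sub>1 > 0" "\<sigma>\<^sub>2 > 0" and \<rho>: "\<rho>\<^sup>2 < 1"
    and UV: "centred_bivariate_normal M U V \<sigma>\<^sub>1 \<sigma>\<^sub>2 \<rho>"
  shows "distributed M lborel (\<lambda>\<omega>. U \<omega> * V \<omega> / (\<sigma>\<^sub>1 * \<sigma>\<^sub>2 * (1 - \<rho>\<^sup>2)))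
    (\<lambda>y. ennreal (sqrt (1 - \<rho>\<^sup>2) * exp (\<rho> * y)) * variance_gamma_density (1 / 2) y)"
proof -
  define c where "c = \<sigma>\<^sub>1 * \<sigma>\<^sub>2 * (1 - \<rho>\<^sup>2)"
  have c: "c > 0" using \<sigma> \<rho> by (simp add: c_def)
  let ?D = "bivariate_normal_density \<sigma>\<^sub>1 \<sigma>\<^sub>2 \<rho>"
  let ?f = "\<lambda>y. ennreal (sqrt (1 - \<rho>\<^sup>2) * exp (\<rho> * y)) * variance_gamma_density (1 / 2) y"
  have D: "distributed M (lborel \<Otimes>\<^sub>M lborel) (\<lambda>\<omega>. (U \<omega>, V \<omega>)) (\<lambda>(u, v). ennreal (?D u v))"
    using UV by (simp add: centred_bivariate_normal_def)
  have UVm: "(\<lambda>\<omega>. (U \<omega>, V \<omega>)) \<in> M \<rightarrow>\<^sub>M lborel \<Otimes>\<^sub>M lborel"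
    by (rule distributed_measurable[OF D])
  have [measurable]: "U \<in> borel_measurable M" "V \<in> borel_measurable M"
    using measurable_compose[OF UVm measurable_fst] measurable_compose[OF UVm measurable_snd] by simp_all
  have "distr M lborel (\<lambda>\<omega>. U \<omega> * V \<omega> / c) = density lborel ?f"
  proof (rule measure_eqI)
    fix A :: "real set" assume "A \<in> sets (distr M lborel (\<lambda>\<omega>. U \<omega> * V \<omega> / c))"
    then have A[measurable]: "A \<in> sets borel" by simp
    have "emeasure (distr M lborel (\<lambda>\<omega>. U \<omega> * V \<omega> / c)) A = (\<integral>\<^sup>+x. indicator A x \<partial>distr M lborel (\<lambda>\<omega>. U \<omega> * V \<omega> / c))"
      by simp
    also have "\<dots> = (\<integral>\<^sup>+\<omega>. (\<lambda>(u, v). indicator A (u * v / c)) (U \<omega>, V \<omega>) \<partial>M)"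
      by (subst nn_integral_distr) simp_all
    also have "\<dots> = (\<integral>\<^sup>+z. (\<lambda>(u, v). ennreal (?D u v)) z * (\<lambda>(u, v). indicator A (u * v / c)) z \<partial>(lborel \<Otimes>\<^sub>M lborel))"
      by (rule distributed_nn_integral[OF D, symmetric]) measurable
    also have "\<dots> = (\<integral>\<^sup>+v. (\<integral>\<^sup>+u. ennreal (?D u v) * indicator A (u * v / c) \<partial>lborel) \<partial>lborel)"
      by (subst lborel_pair.nn_integral_snd[symmetric]) simp_all
    also have "\<dots> = (\<integral>\<^sup>+v. (\<integral>\<^sup>+y. ennreal (\<bar>c / v\<bar> * ?D (c * y / v) v) * indicator A y \<partial>lborel) \<partial>lborel)"
    proof (rule nn_integral_cong_AE)
      show "AE v in lborel. (\<integral>\<^sup>+u. ennreal (?D u v) * indicator A (u * v / c) \<partial>lborel)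
        = (\<integral>\<^sup>+y. ennreal (\<bar>c / v\<bar> * ?D (c * y / v) v) * indicator A y \<partial>lborel)"
        using AE_lborel_singleton[of 0]
      proof eventually_elim
        fix v :: real assume v: "v \<noteq> 0"
        define H where "H u = ennreal (?D u v) * indicator A (u * v / c)" for u
        have [measurable]: "H \<in> borel_measurable borel" unfolding H_def[abs_def] by measurable
        have "(\<integral>\<^sup>+u. H u \<partial>lborel) = ennreal \<bar>c / v\<bar> * (\<integral>\<^sup>+y. H (0 + c / v * y) \<partial>lborel)"
          using v c by (intro nn_integral_real_affine) simp_all
        also have "\<dots> = (\<integral>\<^sup>+y. ennreal \<bar>c / v\<bar> * H (0 + c / v * y) \<partial>lborel)"
          by (rule nn_integral_cmult[symmetric]) measurable
        also have "\<dots> = (\<integral>\<^sup>+y. ennreal (\<bar>c / v\<bar> * ?D (c * y / v) v) * indicator A y \<partial>lborel)"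
        proof (rule nn_integral_cong)
          fix y :: real
          have "(0 + c / v * y) * v / c = y" "0 + c / v * y = c * y / v" using v c by simp_all
          then show "ennreal \<bar>c / v\<bar> * H (0 + c / v * y) = ennreal (\<bar>c / v\<bar> * ?D (c * y / v) v) * indicator A y"
            unfolding H_def by (simp only: ennreal_mult'[OF abs_ge_zero] mult.assoc)
        qed
        finally show "(\<integral>\<^sup>+u. ennreal (?D u v) * indicator A (u * v / c) \<partial>lborel)
          = (\<integral>\<^sup>+y. ennreal (\<bar>c / v\<bar> * ?D (c * y / v) v) * indicator A y \<partial>lborel)"
          unfolding H_def .
      qed
    qed
    also have "\<dots> = (\<integral>\<^sup>+y. (\<integral>\<^sup>+v. ennreal (\<bar>c / v\<bar> * ?D (c * y / v) v) * indicator A y \<partial>lborel) \<partial>lborel)"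
      by (rule nn_integral_swap_lborel) measurable
    also have "\<dots> = (\<integral>\<^sup>+y. (\<integral>\<^sup>+v. ennreal (\<bar>c / v\<bar> * ?D (c * y / v) v) \<partial>lborel) * indicator A y \<partial>lborel)"
      by (rule nn_integral_cong, rule nn_integral_multc) measurable
    also have "\<dots> = emeasure (density lborel ?f) A"
      unfolding c_def nn_integral_bivariate_normal_hyperbola[OF \<sigma> \<rho>]
      by (rule emeasure_density[symmetric]) simp_all
    finally show "emeasure (distr M lborel (\<lambda>\<omega>. U \<omega> * V \<omega> / c)) A = emeasure (density lborel ?f) A" .
  qed simp
  then show ?thesis
    unfolding distributed_def c_def[symmetric] by simp
qed

lemma (in prob_space) distributed_sum_variance_gamma:
  assumes "finite I" "I \<noteq> {}" "indep_vars (\<lambda>_. borel) X I"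
    and "\<And>i. i \<in> I \<Longrightarrow> distributed M lborel (X i) (\<lambda>y. ennreal (c * exp (\<rho> * y)) * variance_gamma_density \<alpha> y)"
    and c: "0 \<le> c" and \<alpha>: "\<alpha> > 0"
  shows "distributed M lborel (\<lambda>\<omega>. \<Sum>i\<in>I. X i \<omega>)
    (\<lambda>y. ennreal (c ^ card I * exp (\<rho> * y)) * variance_gamma_density (real (card I) * \<alpha>) y)"
  using assms(1-4)
proof (induct I rule: finite_ne_induct)
  case (singleton i)
  then show ?case by simp
next
  case (insert i I)
  let ?h = "\<lambda>m y. ennreal (c ^ m * exp (\<rho> * y)) * variance_gamma_density (real m * \<alpha>) y"
  have pos: "card I > 0" using insert by (simp add: card_gt_0_iff)
  have "distributed M lborel (\<lambda>\<omega>. X i \<omega> + (\<Sum>i\<in>I. X i \<omega>)) (\<lambda>y. \<integral>\<^sup>+u. ?h 1 (y - u) * ?h (card I) u \<partial>lborel)"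
  proof (rule distributed_convolution)
    show "indep_var borel (X i) borel (\<lambda>\<omega>. \<Sum>i\<in>I. X i \<omega>)"
      using insert by (intro indep_vars_sum) auto
    show "distributed M lborel (X i) (?h 1)" using insert(6)[of i] by simp
    show "distributed M lborel (\<lambda>\<omega>. \<Sum>i\<in>I. X i \<omega>) (?h (card I))"
      using insert(6) by (intro insert(4) indep_vars_subset[OF insert(5)]) auto
  qed
  also have "(\<lambda>y. \<integral>\<^sup>+u. ?h 1 (y - u) * ?h (card I) u \<partial>lborel) = ?h (card (insert i I))"
  proof
    fix y :: real
    let ?v = variance_gamma_density
    have "(\<integral>\<^sup>+u. ?h 1 (y - u) * ?h (card I) u \<partial>lborel)
      = (\<integral>\<^sup>+u. ennreal (c ^ card (insert i I) * exp (\<rho> * y)) * (?v \<alpha> (y - u) * ?v (real (card I) * \<alpha>) u) \<partial>lborel)"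
    proof (rule nn_integral_cong)
      fix u :: real
      have "(c ^ 1 * exp (\<rho> * (y - u))) * (c ^ card I * exp (\<rho> * u)) = c ^ card (insert i I) * exp (\<rho> * y)"
      proof -
        have "exp (\<rho> * (y - u)) * exp (\<rho> * u) = exp (\<rho> * y)"
          by (simp add: exp_add[symmetric] algebra_simps)
        moreover have "c ^ 1 * c ^ card I = c ^ card (insert i I)" using insert by simp
        ultimately show ?thesis by (metis mult.assoc mult.left_commute)
      qed
      then have "ennreal (c ^ card (insert i I) * exp (\<rho> * y)) = ennreal (c ^ 1 * exp (\<rho> * (y - u))) * ennreal (c ^ card I * exp (\<rho> * u))"
        using c by (subst ennreal_mult[symmetric]) auto
      then show "?h 1 (y - u) * ?h (card I) u
        = ennreal (c ^ card (insert i I) * exp (\<rho> * y)) * (?v \<alpha> (y - u) * ?v (real (card I) * \<alpha>) u)"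
        by (simp only: mult_ac of_nat_1 mult_1_left)
    qed
    also have "\<dots> = ennreal (c ^ card (insert i I) * exp (\<rho> * y)) * (\<integral>\<^sup>+u. ?v \<alpha> (y - u) * ?v (real (card I) * \<alpha>) u \<partial>lborel)"
      by (rule nn_integral_cmult) measurable
    also have "(\<integral>\<^sup>+u. ?v \<alpha> (y - u) * ?v (real (card I) * \<alpha>) u \<partial>lborel) = ?v (\<alpha> + real (card I) * \<alpha>) y"
      using pos \<alpha> by (intro variance_gamma_density_convolution) auto
    also have "\<alpha> + real (card I) * \<alpha> = real (card (insert i I)) * \<alpha>"
      using insert by (simp add: distrib_right)
    finally show "(\<integral>\<^sup>+u. ?h 1 (y - u) * ?h (card I) u \<partial>lborel) = ?h (card (insert i I)) y" .
  qed
  also have "(\<lambda>\<omega>. X i \<omega> + (\<Sum>i\<in>I. X i \<omega>)) = (\<lambda>\<omega>. \<Sum>i\<in>insert i I. X i \<omega>)"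
    using insert by simp
  finally show ?case .
qed

section \<open>Lommel series for variance-gamma tails\<close>

text \<open>
  The coefficient of \<open>1 - G\<close> in the expansion. For \<open>\<nu> = (n - 1) / 2\<close> the last argument of \<open>\<Gamma>\<close> is
  \<open>(n + k) / 2\<close>.
\<close>

definition lommel_tail_term :: "real \<Rightarrow> real \<Rightarrow> nat \<Rightarrow> real" where
  "lommel_tail_term \<nu> \<rho> k = (2 * \<rho>) ^ k / fact k * Gamma ((real k + 1) / 2) * Gamma ((2 * \<nu> + 1 + real k) / 2)"

text \<open>
  Termwise integration of the exponential series. The integrals of the absolute values are summable because
  their partial sums are bounded by the integral with \<open>\<bar>\<rho>\<bar>\<close> in place of \<open>\<rho>\<close>, which is why
  integrability is required for \<open>\<bar>\<rho>\<bar>\<close>.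
\<close>

lemma exp_powr_bessel_K_tail_sums:
  assumes \<nu>: "0 \<le> \<nu>" and x: "0 \<le> x"
    and int: "set_integrable lborel {0<..} (\<lambda>y. exp (\<bar>\<rho>\<bar> * y) * (y powr \<nu> * bessel_K \<nu> y))"
  shows "(\<lambda>k. lommel_tail_term \<nu> \<rho> k * lommel_G_tilde (\<nu> + real k) \<nu> x) sums
    (2 powr (1 - \<nu>) * (LBINT y:{x<..}. exp (\<rho> * y) * (y powr \<nu> * bessel_K \<nu> y)))"
proof -
  let ?\<kappa> = "\<lambda>y. y powr \<nu> * bessel_K \<nu> y"
  define f where "f k y = indicator {x<..} y *\<^sub>R (\<rho> ^ k / fact k * (y powr (\<nu> + real k) * bessel_K \<nu> y))" for k y
  have index: "\<bar>\<nu>\<bar> < \<nu> + real k + 1" for k using \<nu> by simp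
  have powr_k: "y powr (\<nu> + real k) = y ^ k * y powr \<nu>" if "y > 0" for y k
    using that by (simp add: powr_add powr_realpow)
  have exp_sums: "(\<lambda>k. r ^ k / fact k * (y powr (\<nu> + real k) * bessel_K \<nu> y)) sums (exp (r * y) * ?\<kappa> y)"
    if "y > 0" for r y :: real
  proof -
    have "(\<lambda>k. (r * y) ^ k /\<^sub>R fact k * ?\<kappa> y) sums (exp (r * y) * ?\<kappa> y)"
      by (intro sums_mult2 exp_converges)
    moreover have "(r * y) ^ k /\<^sub>R fact k * ?\<kappa> y = r ^ k / fact k * (y powr (\<nu> + real k) * bessel_K \<nu> y)" for k
      using that by (simp add: powr_k power_mult_distrib scaleR_conv_of_real divide_inverse_commute)
    ultimately show ?thesis by simp
  qed
  have int_f: "integrable lborel (f k)" for k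
    using integral_powr_bessel_K_tail(1)[OF index x, of k]
    unfolding f_def[abs_def] set_integrable_def[symmetric] by (rule set_integrable_mult_right)
  have int_x: "set_integrable lborel {x<..} (\<lambda>y. exp (\<bar>\<rho>\<bar> * y) * ?\<kappa> y)"
    using x by (intro set_integrable_subset[OF int]) auto
  have norm_f: "\<bar>f k y\<bar> = indicator {x<..} y *\<^sub>R (\<bar>\<rho>\<bar> ^ k / fact k * (y powr (\<nu> + real k) * bessel_K \<nu> y))" for k y
    by (simp add: f_def abs_mult power_abs bessel_K_nonneg)
  have "(\<lambda>k. integral\<^sup>L lborel (f k)) sums (\<integral>y. (\<Sum>k. f k y) \<partial>lborel)"
  proof (rule sums_integral[OF int_f])
    have "summable (\<lambda>k. norm (f k y))" for y
    proof (cases "y > x")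
      case True
      then show ?thesis using exp_sums[of y "\<bar>\<rho>\<bar>"] x by (simp add: norm_f sums_iff)
    qed (simp add: f_def)
    then show "AE y in lborel. summable (\<lambda>k. norm (f k y))" by simp
    show "summable (\<lambda>k. \<integral>y. norm (f k y) \<partial>lborel)"
    proof (rule summableI_nonneg_bounded)
      fix N :: nat
      have "(\<Sum>k<N. \<integral>y. norm (f k y) \<partial>lborel) = (\<integral>y. (\<Sum>k<N. norm (f k y)) \<partial>lborel)"
        using int_f by (intro Bochner_Integration.integral_sum[symmetric] integrable_norm)
      also have "\<dots> \<le> (\<integral>y. indicator {x<..} y *\<^sub>R (exp (\<bar>\<rho>\<bar> * y) * ?\<kappa> y) \<partial>lborel)"
      proof (rule integral_mono)
        show "integrable lborel (\<lambda>y. \<Sum>k<N. norm (f k y))"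
          using int_f by (intro Bochner_Integration.integrable_sum integrable_norm)
        show "integrable lborel (\<lambda>y. indicator {x<..} y *\<^sub>R (exp (\<bar>\<rho>\<bar> * y) * ?\<kappa> y))"
          using int_x by (simp add: set_integrable_def)
        fix y :: real
        show "(\<Sum>k<N. norm (f k y)) \<le> indicator {x<..} y *\<^sub>R (exp (\<bar>\<rho>\<bar> * y) * ?\<kappa> y)"
        proof (cases "y > x")
          case True
          then have y: "y > 0" using x by simp
          have "(\<Sum>k<N. norm (f k y)) \<le> (\<Sum>k. norm (f k y))"
            using exp_sums[OF y, of "\<bar>\<rho>\<bar>"] True by (intro sum_le_suminf) (auto simp: norm_f sums_iff bessel_K_nonneg)
          also have "\<dots> = exp (\<bar>\<rho>\<bar> * y) * ?\<kappa> y"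
            using exp_sums[OF y, of "\<bar>\<rho>\<bar>"] True by (simp add: norm_f sums_iff)
          finally show ?thesis using True by simp
        qed (simp add: f_def)
      qed
      finally show "(\<Sum>k<N. \<integral>y. norm (f k y) \<partial>lborel)
          \<le> (\<integral>y. indicator {x<..} y *\<^sub>R (exp (\<bar>\<rho>\<bar> * y) * ?\<kappa> y) \<partial>lborel)" .
    qed simp
  qed
  also have "(\<integral>y. (\<Sum>k. f k y) \<partial>lborel) = (LBINT y:{x<..}. exp (\<rho> * y) * ?\<kappa> y)"
    unfolding set_lebesgue_integral_def
  proof (rule Bochner_Integration.integral_cong)
    fix y :: real
    show "(\<Sum>k. f k y) = indicator {x<..} y *\<^sub>R (exp (\<rho> * y) * ?\<kappa> y)"
    proof (cases "y > x")
      case True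
      then show ?thesis using exp_sums[of y \<rho>] x by (simp add: f_def sums_iff)
    qed (simp add: f_def)
  qed simp
  finally have "(\<lambda>k. 2 powr (1 - \<nu>) * integral\<^sup>L lborel (f k)) sums
      (2 powr (1 - \<nu>) * (LBINT y:{x<..}. exp (\<rho> * y) * ?\<kappa> y))"
    by (rule sums_mult)
  moreover have "2 powr (1 - \<nu>) * integral\<^sup>L lborel (f k) = lommel_tail_term \<nu> \<rho> k * lommel_G_tilde (\<nu> + real k) \<nu> x" for k
  proof -
    have "integral\<^sup>L lborel (f k) = \<rho> ^ k / fact k * (LBINT y:{x<..}. y powr (\<nu> + real k) * bessel_K \<nu> y)"
      unfolding f_def set_lebesgue_integral_def[symmetric] by (rule set_integral_mult_right)
    also have "(LBINT y:{x<..}. y powr (\<nu> + real k) * bessel_K \<nu> y)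
      = 2 powr (\<nu> + real k - 1) * Gamma ((\<nu> + real k - \<nu> + 1) / 2) * Gamma ((\<nu> + real k + \<nu> + 1) / 2) * lommel_G_tilde (\<nu> + real k) \<nu> x"
      by (rule integral_powr_bessel_K_tail(2)[OF index x])
    also have "(\<nu> + real k - \<nu> + 1) / 2 = (real k + 1) / 2" by simp
    also have "(\<nu> + real k + \<nu> + 1) / 2 = (2 * \<nu> + 1 + real k) / 2" by simp
    finally have I: "integral\<^sup>L lborel (f k) = \<rho> ^ k / fact k * (2 powr (\<nu> + real k - 1) *
      Gamma ((real k + 1) / 2) * Gamma ((2 * \<nu> + 1 + real k) / 2) * lommel_G_tilde (\<nu> + real k) \<nu> x)" .
    have "2 powr (1 - \<nu>) * 2 powr (\<nu> + real k - 1) = 2 powr real k"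
      by (simp only: powr_add[symmetric]) simp
    then have two: "2 powr (1 - \<nu>) * 2 powr (\<nu> + real k - 1) = 2 ^ k" by (simp add: powr_realpow)
    have "2 powr (1 - \<nu>) * integral\<^sup>L lborel (f k) = (2 powr (1 - \<nu>) * 2 powr (\<nu> + real k - 1)) * (\<rho> ^ k / fact k) *
      Gamma ((real k + 1) / 2) * Gamma ((2 * \<nu> + 1 + real k) / 2) * lommel_G_tilde (\<nu> + real k) \<nu> x"
      unfolding I by (simp only: mult_ac)
    then show ?thesis
      unfolding two lommel_tail_term_def by (simp add: power_mult_distrib)
  qed
  ultimately show ?thesis by simp
qed

lemma fact_odd_eq_pochhammer:
  "(fact (2 * j + 1) :: real) = 4 ^ j * fact j * pochhammer (3 / 2) j"
proof (induct j)
  case (Suc j)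
  have "(fact (2 * Suc j + 1) :: real) = (2 * real j + 3) * (2 * real j + 2) * fact (2 * j + 1)"
    by (simp add: algebra_simps)
  also have "\<dots> = 4 ^ Suc j * fact (Suc j) * pochhammer (3 / 2) (Suc j)"
    unfolding Suc by (simp add: pochhammer_Suc algebra_simps)
  finally show ?case .
qed simp

text \<open>
  Changing the sign of \<open>\<rho>\<close> cancels the terms with even \<open>k\<close>. For \<open>k = 2 j + 1\<close> the factor
  \<open>\<Gamma>((k + 1) / 2)\<close> is \<open>j!\<close>, and \<open>(2 j + 1)! = 4 ^ j j! (3/2)\<^sub>j\<close> brings in the lower parameter \<open>3 / 2\<close>.
\<close>

lemma lommel_tail_term_odd_sums:
  assumes \<nu>: "0 \<le> \<nu>" and sums: "(\<lambda>k. lommel_tail_term \<nu> \<rho> k - lommel_tail_term \<nu> (- \<rho>) k) sums S"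
  shows "S = 4 * \<rho> * Gamma (\<nu> + 1) * hypergeo_2F1 1 (\<nu> + 1) (3 / 2) (\<rho>\<^sup>2)"
proof -
  let ?d = "\<lambda>k. lommel_tail_term \<nu> \<rho> k - lommel_tail_term \<nu> (- \<rho>) k"
  have term_neg: "lommel_tail_term \<nu> (- \<rho>) k = (- 1) ^ k * lommel_tail_term \<nu> \<rho> k" for k
    by (simp add: lommel_tail_term_def power_minus[of "2 * \<rho>"])
  let ?h = "\<lambda>j. pochhammer 1 j * pochhammer (\<nu> + 1) j / pochhammer (3 / 2) j * ((\<rho>\<^sup>2) ^ j / fact j)"
  have odd: "?d (2 * j + 1) = 4 * \<rho> * Gamma (\<nu> + 1) * ?h j" for j
  proof -
    have "Gamma (\<nu> + 1) > 0" using \<nu> by (intro Gamma_real_pos) simp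
    have np: "\<nu> + 1 \<notin> \<int>\<^sub>\<le>\<^sub>0" using \<nu> by (auto dest: nonpos_Ints_nonpos)
    have arg: "(2 * \<nu> + 1 + real (2 * j + 1)) / 2 = \<nu> + 1 + real j" by (simp add: field_simps)
    have G1: "Gamma ((2 * \<nu> + 1 + real (2 * j + 1)) / 2) = Gamma (\<nu> + 1) * pochhammer (\<nu> + 1) j"
      unfolding arg using pochhammer_Gamma[OF np, of j] \<open>Gamma (\<nu> + 1) > 0\<close> by simp
    have arg': "(real (2 * j + 1) + 1) / 2 = 1 + real j" by (simp add: field_simps)
    have G2: "Gamma ((real (2 * j + 1) + 1) / 2) = fact j"
      unfolding arg' by (rule Gamma_fact)
    have pw: "(2 * \<rho>) ^ (2 * j + 1) = 2 * \<rho> * 4 ^ j * (\<rho>\<^sup>2) ^ j"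
      by (simp add: power_mult power_mult_distrib)
    have L: "lommel_tail_term \<nu> \<rho> (2 * j + 1) = 2 * \<rho> * Gamma (\<nu> + 1) * ?h j"
    proof -
      have cancel: "2 * \<rho> * q * R / (q * F * P) * F * (G * Q) = 2 * \<rho> * G * (F * Q / P * (R / F))"
        if "q \<noteq> 0" "F \<noteq> 0" for q R F P G Q :: real
        using that by simp
      have "pochhammer 1 j = (fact j :: real)" by (rule pochhammer_fact[symmetric])
      then show ?thesis
        unfolding lommel_tail_term_def G1 G2 pw fact_odd_eq_pochhammer by (simp only: cancel fact_nonzero power_not_zero zero_neq_numeral not_False_eq_True)
    qed
    have "(- 1 :: real) ^ (2 * j + 1) = - 1" by simp
    with term_neg[of "2 * j + 1"]
    have "lommel_tail_term \<nu> (- \<rho>) (2 * j + 1) = - lommel_tail_term \<nu> \<rho> (2 * j + 1)" by (simp only: mult_minus1)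
    then have "?d (2 * j + 1) = 2 * lommel_tail_term \<nu> \<rho> (2 * j + 1)" by linarith
    also have "\<dots> = 4 * \<rho> * Gamma (\<nu> + 1) * ?h j"
    proof -
      have "2 * (2 * \<rho> * G * h) = 4 * \<rho> * G * h" for G h :: real by simp
      then show ?thesis unfolding L .
    qed
    finally show ?thesis .
  qed
  have "strict_mono (\<lambda>j::nat. 2 * j + 1)" by (rule strict_monoI) simp
  moreover have "?d k = 0" if "k \<notin> range (\<lambda>j::nat. 2 * j + 1)" for k
  proof -
    have "even k" using that by (metis oddE rangeI)
    then show ?thesis by (simp add: term_neg)
  qed
  ultimately have "(\<lambda>j. ?d (2 * j + 1)) sums S"
    using sums by (subst sums_mono_reindex) auto
  then have *: "(\<lambda>j. 4 * \<rho> * Gamma (\<nu> + 1) * ?h j) sums S" unfolding odd .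
  show ?thesis
  proof (cases "\<rho> = 0")
    case True
    then have "(\<lambda>j::nat. 0) sums S" using * by simp
    then show ?thesis using True by (simp add: sums_iff)
  next
    case False
    moreover have "Gamma (\<nu> + 1) > 0" using \<nu> by (intro Gamma_real_pos) simp
    ultimately have "4 * \<rho> * Gamma (\<nu> + 1) \<noteq> 0" by simp
    have "summable ?h" by (rule summable_mult_D[OF sums_summable[OF *]]) fact
    from sums_mult[OF summable_sums[OF this], of "4 * \<rho> * Gamma (\<nu> + 1)"] show ?thesis
      unfolding hypergeo_2F1_def by (rule sums_unique2[OF *])
  qed
qed

text \<open>
  The real-valued form of the tilted density of shape \<open>\<nu> + 1 / 2\<close>. Both agree off \<open>y = 0\<close>, where this one is
  finite by the default values of \<open>K\<close> and \<open>powr\<close>.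
\<close>

definition variance_gamma_pdf :: "real \<Rightarrow> real \<Rightarrow> real \<Rightarrow> real" where
  "variance_gamma_pdf \<nu> \<rho> y = (1 - \<rho>\<^sup>2) powr (\<nu> + 1 / 2) / (2 * sqrt pi * Gamma (\<nu> + 1 / 2)) *
     (2 powr (1 - \<nu>) * (exp (\<rho> * y) * (\<bar>y\<bar> powr \<nu> * bessel_K \<nu> \<bar>y\<bar>)))"

lemma variance_gamma_density_eq_pdf:
  assumes "0 \<le> \<nu>" "\<rho>\<^sup>2 < 1" "y \<noteq> 0"
  shows "ennreal ((1 - \<rho>\<^sup>2) powr (\<nu> + 1 / 2) * exp (\<rho> * y)) * variance_gamma_density (\<nu> + 1 / 2) y = ennreal (variance_gamma_pdf \<nu> \<rho> y)"
proof -
  define G where "G = Gamma (\<nu> + 1 / 2)"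
  have G: "G > 0" unfolding G_def using assms by (intro Gamma_real_pos) simp
  have y: "\<bar>y\<bar> > 0" "\<bar>y\<bar>\<^sup>2 = y\<^sup>2" "\<nu> + 1 / 2 - 1 / 2 = \<nu>" using assms by simp_all
  have "variance_gamma_density (\<nu> + 1 / 2) y = ennreal (1 / (2 * sqrt pi * G)) * ennreal (2 * (\<bar>y\<bar> / 2) powr \<nu> * bessel_K \<nu> \<bar>y\<bar>)"
    using variance_gamma_density_eq[of "\<nu> + 1 / 2" y] bessel_K_integral_representation[OF y(1), of \<nu>] assms
    unfolding y G_def by simp
  also have "2 * (\<bar>y\<bar> / 2) powr \<nu> * bessel_K \<nu> \<bar>y\<bar> = 2 powr (1 - \<nu>) * (\<bar>y\<bar> powr \<nu> * bessel_K \<nu> \<bar>y\<bar>)"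
    by (simp add: powr_divide powr_diff)
  also have "ennreal ((1 - \<rho>\<^sup>2) powr (\<nu> + 1 / 2) * exp (\<rho> * y)) * (ennreal (1 / (2 * sqrt pi * G)) * ennreal \<dots>)
     = ennreal (((1 - \<rho>\<^sup>2) powr (\<nu> + 1 / 2) * exp (\<rho> * y)) * ((1 / (2 * sqrt pi * G)) * (2 powr (1 - \<nu>) * (\<bar>y\<bar> powr \<nu> * bessel_K \<nu> \<bar>y\<bar>))))"
    using G by (simp only: ennreal_mult[symmetric] powr_ge_zero mult_nonneg_nonneg exp_ge_zero bessel_K_nonneg
      less_imp_le zero_le_divide_1_iff zero_le_numeral real_sqrt_ge_zero pi_ge_zero)
  also have "((1 - \<rho>\<^sup>2) powr (\<nu> + 1 / 2) * exp (\<rho> * y)) * ((1 / (2 * sqrt pi * G)) * (2 powr (1 - \<nu>) * (\<bar>y\<bar> powr \<nu> * bessel_K \<nu> \<bar>y\<bar>))) = variance_gamma_pdf \<nu> \<rho> y"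
    unfolding variance_gamma_pdf_def G_def[symmetric]
    by (simp only: times_divide_eq_left times_divide_eq_right mult_1_left mult_ac)
  finally show ?thesis .
qed

lemma distributed_variance_gamma_pdf:
  fixes X :: "nat \<Rightarrow> 'b \<Rightarrow> real" and n :: nat
  assumes N: "prob_space N" and n: "n \<ge> 1" and \<rho>: "\<rho>\<^sup>2 < 1"
    and indep: "prob_space.indep_vars N (\<lambda>_. borel) X {1..n}"
    and X: "\<And>i. i \<in> {1..n} \<Longrightarrow> distributed N lborel (X i) (\<lambda>y. ennreal (sqrt (1 - \<rho>\<^sup>2) * exp (\<rho> * y)) * variance_gamma_density (1 / 2) y)"
  shows "distributed N lborel (\<lambda>\<omega>. \<Sum>i = 1..n. X i \<omega>) (\<lambda>y. ennreal (variance_gamma_pdf ((real n - 1) / 2) \<rho> y))"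
proof -
  interpret prob_space N by (rule N)
  have r: "1 - \<rho>\<^sup>2 > 0" using \<rho> by simp
  have card_n: "card {1..n} = n" by simp
  have half: "real n * (1 / 2) = (real n - 1) / 2 + 1 / 2" by (simp add: field_simps)
  have pw: "sqrt (1 - \<rho>\<^sup>2) ^ n = (1 - \<rho>\<^sup>2) powr ((real n - 1) / 2 + 1 / 2)"
  proof -
    have "sqrt (1 - \<rho>\<^sup>2) ^ n = ((1 - \<rho>\<^sup>2) powr (1 / 2)) powr real n"
      using r by (simp add: powr_half_sqrt powr_realpow)
    then show ?thesis unfolding powr_powr half[symmetric] by (simp only: mult.commute)
  qed
  have "distributed N lborel (\<lambda>\<omega>. \<Sum>i\<in>{1..n}. X i \<omega>)
    (\<lambda>y. ennreal (sqrt (1 - \<rho>\<^sup>2) ^ card {1..n} * exp (\<rho> * y)) * variance_gamma_density (real (card {1..n}) * (1 / 2)) y)"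
    using n r by (intro distributed_sum_variance_gamma indep X) auto
  then have D: "distributed N lborel (\<lambda>\<omega>. \<Sum>i = 1..n. X i \<omega>)
    (\<lambda>y. ennreal ((1 - \<rho>\<^sup>2) powr ((real n - 1) / 2 + 1 / 2) * exp (\<rho> * y)) * variance_gamma_density ((real n - 1) / 2 + 1 / 2) y)"
    unfolding card_n pw half .
  show ?thesis
  proof (rule distributed_cong_density[THEN iffD1, OF _ _ _ D])
    show "AE y in lborel. ennreal ((1 - \<rho>\<^sup>2) powr ((real n - 1) / 2 + 1 / 2) * exp (\<rho> * y)) * variance_gamma_density ((real n - 1) / 2 + 1 / 2) y
      = ennreal (variance_gamma_pdf ((real n - 1) / 2) \<rho> y)"
      using AE_lborel_singleton[of 0]
      by eventually_elim (rule variance_gamma_density_eq_pdf, use n \<rho> in auto)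
    show "(\<lambda>y. ennreal (variance_gamma_pdf ((real n - 1) / 2) \<rho> y)) \<in> borel_measurable lborel"
      unfolding variance_gamma_pdf_def by measurable
  qed measurable
qed

text \<open>
  Integrability of \<open>exp (\<bar>\<rho>\<bar> y) y powr \<nu> K\<^sub>\<nu>(y)\<close> comes for free from the existence of \<open>Y\<close>: the density is
  integrable on both half-lines, and on one of them the tilt is \<open>exp (\<bar>\<rho>\<bar> \<bar>y\<bar>)\<close>.
\<close>

lemma (in prob_space) variance_gamma_cdf:
  assumes \<nu>: "0 \<le> \<nu>" and Y: "distributed M lborel Y (\<lambda>y. ennreal (variance_gamma_pdf \<nu> \<rho> y))" and \<rho>: "\<rho>\<^sup>2 < 1"
  defines "C \<equiv> (1 - \<rho>\<^sup>2) powr (\<nu> + 1 / 2) / (2 * sqrt pi * Gamma (\<nu> + 1 / 2))"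
  shows "0 \<le> x \<Longrightarrow> (\<lambda>k. C * (lommel_tail_term \<nu> \<rho> k * lommel_G_tilde (\<nu> + real k) \<nu> x)) sums (1 - prob {\<omega> \<in> space M. Y \<omega> \<le> x})"
    and "x \<le> 0 \<Longrightarrow> (\<lambda>k. C * (lommel_tail_term \<nu> (- \<rho>) k * lommel_G_tilde (\<nu> + real k) \<nu> (- x))) sums prob {\<omega> \<in> space M. Y \<omega> \<le> x}"
proof -
  let ?g = "variance_gamma_pdf \<nu> \<rho>" and ?\<kappa> = "\<lambda>y. y powr \<nu> * bessel_K \<nu> y"
  have C: "C > 0" unfolding C_def using \<nu> \<rho> by (intro divide_pos_pos mult_pos_pos Gamma_real_pos) auto
  have g_nonneg: "0 \<le> ?g y" for y
    unfolding variance_gamma_pdf_def C_def[symmetric] using C by (auto intro!: mult_nonneg_nonneg bessel_K_nonneg)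
  have [measurable]: "?g \<in> borel_measurable borel" unfolding variance_gamma_pdf_def[abs_def] by measurable
  have [measurable]: "Y \<in> borel_measurable M" using distributed_measurable[OF Y] by simp
  have prob_eq: "integrable lborel (\<lambda>y. indicator A y *\<^sub>R ?g y)" "prob {\<omega> \<in> space M. Y \<omega> \<in> A} = (LBINT y:A. ?g y)"
    if [measurable]: "A \<in> sets borel" for A
  proof -
    have "ennreal (prob {\<omega> \<in> space M. Y \<omega> \<in> A}) = emeasure M (Y -` A \<inter> space M)"
      by (simp add: emeasure_eq_measure vimage_def Int_def conj_commute)
    also have "\<dots> = (\<integral>\<^sup>+y. ennreal (?g y) * indicator A y \<partial>lborel)"
      by (rule distributed_emeasure[OF Y]) simp
    also have "\<dots> = (\<integral>\<^sup>+y. ennreal (indicator A y *\<^sub>R ?g y) \<partial>lborel)"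
      by (intro nn_integral_cong) (simp split: split_indicator)
    finally have "has_bochner_integral lborel (\<lambda>y. indicator A y *\<^sub>R ?g y) (prob {\<omega> \<in> space M. Y \<omega> \<in> A})"
      using g_nonneg by (intro has_bochner_integral_nn_integral) auto
    then show "integrable lborel (\<lambda>y. indicator A y *\<^sub>R ?g y)" "prob {\<omega> \<in> space M. Y \<omega> \<in> A} = (LBINT y:A. ?g y)"
      by (simp_all add: has_bochner_integral_iff set_lebesgue_integral_def)
  qed
  have g_pos: "?g y = C * (2 powr (1 - \<nu>) * (exp (\<rho> * y) * ?\<kappa> y))" if "y > 0" for y
    using that by (simp add: variance_gamma_pdf_def C_def)
  have g_neg: "?g (- y) = C * (2 powr (1 - \<nu>) * (exp (- \<rho> * y) * ?\<kappa> y))" if "y > 0" for y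
    using that by (simp add: variance_gamma_pdf_def C_def)
  have right: "set_integrable lborel {0<..} (\<lambda>y. exp (\<rho> * y) * ?\<kappa> y)"
  proof -
    have "set_integrable lborel {0<..} ?g" using prob_eq(1)[of "{0<..}"] by (simp add: set_integrable_def)
    then have "set_integrable lborel {0<..} (\<lambda>y. 1 / (C * 2 powr (1 - \<nu>)) * ?g y)" by (rule set_integrable_mult_right)
    then show ?thesis
      by (rule set_integrable_cong[THEN iffD1, rotated -1]) (use C in \<open>simp_all add: g_pos\<close>)
  qed
  have left: "set_integrable lborel {0<..} (\<lambda>y. exp (- \<rho> * y) * ?\<kappa> y)"
  proof -
    have "integrable lborel (\<lambda>y. indicator {..<0} y *\<^sub>R ?g y)" using prob_eq(1)[of "{..<0}"] by simp
    then have "integrable lborel (\<lambda>y. indicator {..<0} (- y) *\<^sub>R ?g (- y))"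
      by (subst lborel_integral_reflect(1)[of "\<lambda>y. indicator {..<0} y *\<^sub>R ?g y"])
    moreover have "indicator {..<0} (- y) = (indicator {0<..} y :: real)" for y :: real by (simp split: split_indicator)
    ultimately have "set_integrable lborel {0<..} (\<lambda>y. ?g (- y))" by (simp add: set_integrable_def)
    then have "set_integrable lborel {0<..} (\<lambda>y. 1 / (C * 2 powr (1 - \<nu>)) * ?g (- y))" by (rule set_integrable_mult_right)
    then show ?thesis
      by (rule set_integrable_cong[THEN iffD1, rotated -1]) (use C in \<open>simp_all add: g_neg\<close>)
  qed
  have int: "set_integrable lborel {0<..} (\<lambda>y. exp (\<bar>\<rho>\<bar> * y) * ?\<kappa> y)"
    using right left by (cases "0 \<le> \<rho>") simp_all
  show "(\<lambda>k. C * (lommel_tail_term \<nu> \<rho> k * lommel_G_tilde (\<nu> + real k) \<nu> x)) sums (1 - prob {\<omega> \<in> space M. Y \<omega> \<le> x})" if x: "0 \<le> x"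
  proof -
    have "1 - prob {\<omega> \<in> space M. Y \<omega> \<le> x} = prob (space M - {\<omega> \<in> space M. Y \<omega> \<le> x})"
      by (rule prob_compl[symmetric]) measurable
    also have "space M - {\<omega> \<in> space M. Y \<omega> \<le> x} = {\<omega> \<in> space M. Y \<omega> \<in> {x<..}}" by auto
    also have "prob \<dots> = (LBINT y:{x<..}. ?g y)" by (rule prob_eq) simp
    also have "\<dots> = (LBINT y:{x<..}. C * (2 powr (1 - \<nu>) * (exp (\<rho> * y) * ?\<kappa> y)))"
      using x by (intro set_lebesgue_integral_cong) (auto simp: g_pos)
    also have "\<dots> = C * (2 powr (1 - \<nu>) * (LBINT y:{x<..}. exp (\<rho> * y) * ?\<kappa> y))"
      by (simp only: set_integral_mult_right)
    finally show ?thesis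
      by (simp only:) (intro sums_mult exp_powr_bessel_K_tail_sums \<nu> x int)
  qed
  show "(\<lambda>k. C * (lommel_tail_term \<nu> (- \<rho>) k * lommel_G_tilde (\<nu> + real k) \<nu> (- x))) sums prob {\<omega> \<in> space M. Y \<omega> \<le> x}" if x: "x \<le> 0"
  proof -
    have "prob {\<omega> \<in> space M. Y \<omega> \<le> x} = prob {\<omega> \<in> space M. Y \<omega> \<in> {..x}}" by simp
    also have "\<dots> = (LBINT y:{..x}. ?g y)" by (rule prob_eq) simp
    also have "\<dots> = (\<integral>y. indicator {..x} (- y) *\<^sub>R ?g (- y) \<partial>lborel)"
      unfolding set_lebesgue_integral_def by (rule lborel_integral_reflect(2)[symmetric])
    also have "\<dots> = (LBINT y:{- x<..}. C * (2 powr (1 - \<nu>) * (exp (- \<rho> * y) * ?\<kappa> y)))"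
      unfolding set_lebesgue_integral_def
    proof (rule integral_cong_AE)
      show "AE y in lborel. indicator {..x} (- y) *\<^sub>R ?g (- y) = indicator {- x<..} y *\<^sub>R (C * (2 powr (1 - \<nu>) * (exp (- \<rho> * y) * ?\<kappa> y)))"
        using AE_lborel_singleton[of "- x"]
      proof eventually_elim
        fix y :: real assume "y \<noteq> - x"
        then show "indicator {..x} (- y) *\<^sub>R ?g (- y) = indicator {- x<..} y *\<^sub>R (C * (2 powr (1 - \<nu>) * (exp (- \<rho> * y) * ?\<kappa> y)))"
          using x g_neg[of y] by (cases "y > - x") auto
      qed
    qed measurable
    also have "\<dots> = C * (2 powr (1 - \<nu>) * (LBINT y:{- x<..}. exp (- \<rho> * y) * ?\<kappa> y))"
      by (simp only: set_integral_mult_right)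
    finally show ?thesis
      using x int by (simp only:) (intro sums_mult exp_powr_bessel_K_tail_sums \<nu>, simp_all)
  qed
qed

section \<open>The distribution of the sample mean\<close>

theorem corollary2p3:
  fixes M :: "'a measure" and N :: "'b measure"
    and U V :: "'a \<Rightarrow> real" and Z :: "nat \<Rightarrow> 'b \<Rightarrow> real"
    and \<sigma>\<^sub>U \<sigma>\<^sub>V \<rho> s :: real and n :: nat
  assumes "prob_space M" and "prob_space N"
    and "\<sigma>\<^sub>U > 0" and "\<sigma>\<^sub>V > 0" and "-1 < \<rho>" and "\<rho> < 1"
    and "centred_bivariate_normal M U V \<sigma>\<^sub>U \<sigma>\<^sub>V \<rho>"
    and "s = \<sigma>\<^sub>U * \<sigma>\<^sub>V"
    and "n \<ge> 1"
    and "prob_space.indep_vars N (\<lambda>_. borel) Z {1..n}"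
    and "\<And>i. i \<in> {1..n} \<Longrightarrow> distr N borel (Z i) = distr M borel (\<lambda>\<omega>. U \<omega> * V \<omega>)"
  shows
    "(\<forall>x\<ge>0.
        summable (\<lambda>k. (2 * \<rho>) ^ k / fact k * Gamma ((real k + 1) / 2) * Gamma ((real n + real k) / 2) *
            lommel_G_tilde ((real n - 1) / 2 + real k) ((real n - 1) / 2) (real n * x / (s * (1 - \<rho>\<^sup>2)))) \<and>
        cdf (distr N borel (sample_mean n Z)) x =
          1 - (1 - \<rho>\<^sup>2) powr (real n / 2) / (2 * sqrt pi * Gamma (real n / 2)) *
            (\<Sum>k. (2 * \<rho>) ^ k / fact k * Gamma ((real k + 1) / 2) * Gamma ((real n + real k) / 2) *
               lommel_G_tilde ((real n - 1) / 2 + real k) ((real n - 1) / 2) (real n * x / (s * (1 - \<rho>\<^sup>2)))))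
     \<and> (\<forall>x<0.
        summable (\<lambda>k. (- 2 * \<rho>) ^ k / fact k * Gamma ((real k + 1) / 2) * Gamma ((real n + real k) / 2) *
            lommel_G_tilde ((real n - 1) / 2 + real k) ((real n - 1) / 2) (- (real n * x / (s * (1 - \<rho>\<^sup>2))))) \<and>
        cdf (distr N borel (sample_mean n Z)) x =
          (1 - \<rho>\<^sup>2) powr (real n / 2) / (2 * sqrt pi * Gamma (real n / 2)) *
            (\<Sum>k. (- 2 * \<rho>) ^ k / fact k * Gamma ((real k + 1) / 2) * Gamma ((real n + real k) / 2) *
               lommel_G_tilde ((real n - 1) / 2 + real k) ((real n - 1) / 2) (- (real n * x / (s * (1 - \<rho>\<^sup>2))))))
     \<and> (\<forall>x.
        summable (\<lambda>k. sgn x ^ (k + 1) * ((2 * \<rho>) ^ k / fact k) * Gamma ((real k + 1) / 2) * Gamma ((real n + real k) / 2) *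
            lommel_G ((real n - 1) / 2 + real k) ((real n - 1) / 2) (real n * \<bar>x\<bar> / (s * (1 - \<rho>\<^sup>2)))) \<and>
        cdf (distr N borel (sample_mean n Z)) x =
          1 / 2
          - Gamma ((real n + 1) / 2) / (sqrt pi * Gamma (real n / 2)) * \<rho> * (1 - \<rho>\<^sup>2) powr (real n / 2) *
              hypergeo_2F1 1 ((real n + 1) / 2) (3 / 2) (\<rho>\<^sup>2)
          + (1 - \<rho>\<^sup>2) powr (real n / 2) / (2 * sqrt pi * Gamma (real n / 2)) *
            (\<Sum>k. sgn x ^ (k + 1) * ((2 * \<rho>) ^ k / fact k) * Gamma ((real k + 1) / 2) * Gamma ((real n + real k) / 2) *
               lommel_G ((real n - 1) / 2 + real k) ((real n - 1) / 2) (real n * \<bar>x\<bar> / (s * (1 - \<rho>\<^sup>2)))))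
     \<and> measure N {\<omega> \<in> space N. sample_mean n Z \<omega> \<le> 0} =
          1 / 2
          - Gamma ((real n + 1) / 2) / (sqrt pi * Gamma (real n / 2)) * \<rho> * (1 - \<rho>\<^sup>2) powr (real n / 2) *
              hypergeo_2F1 1 ((real n + 1) / 2) (3 / 2) (\<rho>\<^sup>2)"
proof -
  interpret N: prob_space N by fact
  have r: "\<rho>\<^sup>2 < 1" using \<open>- 1 < \<rho>\<close> \<open>\<rho> < 1\<close> by (intro abs_square_less_1[THEN iffD2]) auto
  define c where "c = s * (1 - \<rho>\<^sup>2)"
  have c_eq: "c = \<sigma>\<^sub>U * \<sigma>\<^sub>V * (1 - \<rho>\<^sup>2)" by (simp add: c_def \<open>s = \<sigma>\<^sub>U * \<sigma>\<^sub>V\<close>)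
  have c: "c > 0" using r \<open>\<sigma>\<^sub>U > 0\<close> \<open>\<sigma>\<^sub>V > 0\<close> by (simp add: c_eq)
  have n: "real n > 0" using \<open>n \<ge> 1\<close> by simp
  define \<nu> where "\<nu> = (real n - 1) / 2"
  have \<nu>: "0 \<le> \<nu>" and \<nu>_half: "\<nu> + 1 / 2 = real n / 2" and \<nu>_one: "\<nu> + 1 = (real n + 1) / 2"
    using \<open>n \<ge> 1\<close> by (simp_all add: \<nu>_def field_simps)
  define C where "C = (1 - \<rho>\<^sup>2) powr (real n / 2) / (2 * sqrt pi * Gamma (real n / 2))"
  have C: "C > 0" unfolding C_def using r n by (intro divide_pos_pos mult_pos_pos Gamma_real_pos) auto
  \<comment> \<open>Dividing by \<open>c\<close> normalises the scale, so that the density depends on \<open>n\<close> and \<open>\<rho>\<close> only.\<close>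
  define Y where "Y \<omega> = (\<Sum>i = 1..n. Z i \<omega> / c)" for \<omega>
  define Q where "Q x = N.prob {\<omega> \<in> space N. Y \<omega> \<le> x}" for x

  have UV: "distributed M lborel (\<lambda>\<omega>. U \<omega> * V \<omega> / c)
      (\<lambda>y. ennreal (sqrt (1 - \<rho>\<^sup>2) * exp (\<rho> * y)) * variance_gamma_density (1 / 2) y)"
    unfolding c_eq using assms r by (intro distributed_product_centred_bivariate_normal)
  have Z_meas: "Z i \<in> borel_measurable N" if "i \<in> {1..n}" for i
    using \<open>N.indep_vars (\<lambda>_. borel) Z {1..n}\<close> that by (simp add: N.indep_vars_def)
  have UV_meas: "(\<lambda>\<omega>. U \<omega> * V \<omega>) \<in> borel_measurable M"
  proof -
    have "(\<lambda>\<omega>. U \<omega> * V \<omega> / c * c) \<in> borel_measurable M"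
      using distributed_measurable[OF UV] by (intro borel_measurable_times) auto
    then show ?thesis using c by simp
  qed
  have X: "distributed N lborel (\<lambda>\<omega>. Z i \<omega> / c)
      (\<lambda>y. ennreal (sqrt (1 - \<rho>\<^sup>2) * exp (\<rho> * y)) * variance_gamma_density (1 / 2) y)" if i: "i \<in> {1..n}" for i
  proof -
    have div: "(\<lambda>z. z / c) \<in> borel \<rightarrow>\<^sub>M lborel" by simp
    have "distr N lborel (\<lambda>\<omega>. Z i \<omega> / c) = distr (distr N borel (Z i)) lborel (\<lambda>z. z / c)"
      by (subst distr_distr[OF div Z_meas[OF i]]) (simp add: comp_def)
    also have "\<dots> = distr (distr M borel (\<lambda>\<omega>. U \<omega> * V \<omega>)) lborel (\<lambda>z. z / c)"
      using assms(11)[OF i] by simp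
    also have "\<dots> = distr M lborel (\<lambda>\<omega>. U \<omega> * V \<omega> / c)"
      by (subst distr_distr[OF div UV_meas]) (simp add: comp_def)
    finally show ?thesis
      using UV measurable_compose[OF Z_meas[OF i] div] unfolding distributed_def by simp
  qed
  have indep: "N.indep_vars (\<lambda>_. borel) (\<lambda>i \<omega>. Z i \<omega> / c) {1..n}"
    by (rule N.indep_vars_compose2[OF \<open>N.indep_vars (\<lambda>_. borel) Z {1..n}\<close>]) simp
  have Y: "distributed N lborel Y (\<lambda>y. ennreal (variance_gamma_pdf \<nu> \<rho> y))"
    unfolding Y_def[abs_def] \<nu>_def by (rule distributed_variance_gamma_pdf[OF \<open>prob_space N\<close> \<open>n \<ge> 1\<close> r indep X])

  have mean_le: "sample_mean n Z \<omega> \<le> x \<longleftrightarrow> Y \<omega> \<le> real n * x / c" for \<omega> x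
    unfolding sample_mean_def Y_def sum_divide_distrib[symmetric] using n c
    by (simp add: divide_le_cancel pos_divide_le_eq mult.commute)
  have mean_meas: "sample_mean n Z \<in> borel_measurable N"
    unfolding sample_mean_def[abs_def] by (intro borel_measurable_divide borel_measurable_sum Z_meas borel_measurable_const)
  have cdf_eq: "cdf (distr N borel (sample_mean n Z)) x = Q (real n * x / c)" for x
  proof -
    have "sample_mean n Z -` {..x} \<inter> space N = {\<omega> \<in> space N. Y \<omega> \<le> real n * x / c}"
      by (auto simp: mean_le)
    then show ?thesis unfolding cdf_def Q_def by (subst measure_distr[OF mean_meas]) simp_all
  qed

  have t_eq: "lommel_tail_term \<nu> r k = (2 * r) ^ k / fact k * Gamma ((real k + 1) / 2) * Gamma ((real n + real k) / 2)" for r k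
  proof -
    have "2 * \<nu> + 1 = real n" by (simp add: \<nu>_def field_simps)
    then show ?thesis unfolding lommel_tail_term_def by (simp only:)
  qed
  have upper: "(\<lambda>k. lommel_tail_term \<nu> \<rho> k * lommel_G_tilde (\<nu> + real k) \<nu> x) sums ((1 - Q x) / C)" if "0 \<le> x" for x
  proof -
    have "(\<lambda>k. C * (lommel_tail_term \<nu> \<rho> k * lommel_G_tilde (\<nu> + real k) \<nu> x)) sums (1 - Q x)"
      using N.variance_gamma_cdf(1)[OF \<nu> Y r that] unfolding \<nu>_half C_def[symmetric] Q_def .
    from sums_divide[OF this, of C] show ?thesis using C by simp
  qed
  have lower: "(\<lambda>k. lommel_tail_term \<nu> (- \<rho>) k * lommel_G_tilde (\<nu> + real k) \<nu> (- x)) sums (Q x / C)" if "x \<le> 0" for x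
  proof -
    have "(\<lambda>k. C * (lommel_tail_term \<nu> (- \<rho>) k * lommel_G_tilde (\<nu> + real k) \<nu> (- x))) sums Q x"
      using N.variance_gamma_cdf(2)[OF \<nu> Y r that] unfolding \<nu>_half C_def[symmetric] Q_def .
    from sums_divide[OF this, of C] show ?thesis using C by simp
  qed
  \<comment> \<open>At \<open>0\<close> both expansions are available, and together they determine \<open>Q 0\<close>.\<close>
  have G_tilde_0: "lommel_G_tilde m \<nu> 0 = 1" for m by (simp add: lommel_G_tilde_def lommel_G_def)
  have upper0: "lommel_tail_term \<nu> \<rho> sums ((1 - Q 0) / C)" using upper[of 0] by (simp add: G_tilde_0)
  have lower0: "lommel_tail_term \<nu> (- \<rho>) sums (Q 0 / C)" using lower[of 0] by (simp add: G_tilde_0)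

  have Q0: "Q 0 = 1 / 2 - Gamma ((real n + 1) / 2) / (sqrt pi * Gamma (real n / 2)) * \<rho> * (1 - \<rho>\<^sup>2) powr (real n / 2) *
      hypergeo_2F1 1 ((real n + 1) / 2) (3 / 2) (\<rho>\<^sup>2)"
  proof -
    define H where "H = hypergeo_2F1 1 ((real n + 1) / 2) (3 / 2) (\<rho>\<^sup>2)"
    have "(1 - Q 0) / C - Q 0 / C = 4 * \<rho> * Gamma ((real n + 1) / 2) * H"
      using lommel_tail_term_odd_sums[OF \<nu> sums_diff[OF upper0 lower0]] unfolding \<nu>_one H_def .
    also have "(1 - Q 0) / C - Q 0 / C = (1 - 2 * Q 0) / C"
      by (simp add: diff_divide_distrib[symmetric])
    finally have "1 - 2 * Q 0 = 4 * \<rho> * Gamma ((real n + 1) / 2) * H * C"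
      using C by (subst (asm) nonzero_divide_eq_eq) simp_all
    moreover have "4 * \<rho> * Gamma ((real n + 1) / 2) * H * C
        = 2 * (Gamma ((real n + 1) / 2) / (sqrt pi * Gamma (real n / 2)) * \<rho> * (1 - \<rho>\<^sup>2) powr (real n / 2) * H)"
      unfolding C_def by simp
    ultimately show ?thesis unfolding H_def[symmetric] by linarith
  qed

  have signed: "(\<lambda>k. sgn x ^ (k + 1) * ((2 * \<rho>) ^ k / fact k) * Gamma ((real k + 1) / 2) * Gamma ((real n + real k) / 2) *
      lommel_G (\<nu> + real k) \<nu> (real n * \<bar>x\<bar> / c)) sums ((Q (real n * x / c) - Q 0) / C)" for x
  proof -
    consider "x > 0" | "x = 0" | "x < 0" by linarith
    then show ?thesis
    proof cases
      case 1
      have "(\<lambda>k. lommel_tail_term \<nu> \<rho> k - lommel_tail_term \<nu> \<rho> k * lommel_G_tilde (\<nu> + real k) \<nu> (real n * x / c))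
          sums ((1 - Q 0) / C - (1 - Q (real n * x / c)) / C)"
        using 1 n c by (intro sums_diff upper0 upper) simp
      moreover have "(1 - Q 0) / C - (1 - Q (real n * x / c)) / C = (Q (real n * x / c) - Q 0) / C"
        by (simp add: diff_divide_distrib)
      moreover have "lommel_tail_term \<nu> \<rho> k - lommel_tail_term \<nu> \<rho> k * lommel_G_tilde (\<nu> + real k) \<nu> (real n * x / c)
          = sgn x ^ (k + 1) * ((2 * \<rho>) ^ k / fact k) * Gamma ((real k + 1) / 2) * Gamma ((real n + real k) / 2) *
            lommel_G (\<nu> + real k) \<nu> (real n * \<bar>x\<bar> / c)" for k
        unfolding t_eq lommel_G_tilde_def using 1 by (simp add: right_diff_distrib)
      ultimately show ?thesis by simp
    next
      case 2
      then show ?thesis by simp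
    next
      case 3
      have nonpos: "real n * x / c \<le> 0" using 3 n c by (simp add: mult_nonneg_nonpos divide_nonpos_pos)
      have "(\<lambda>k. lommel_tail_term \<nu> (- \<rho>) k * lommel_G_tilde (\<nu> + real k) \<nu> (- (real n * x / c)) - lommel_tail_term \<nu> (- \<rho>) k)
          sums (Q (real n * x / c) / C - Q 0 / C)"
        by (intro sums_diff lower0 lower nonpos)
      moreover have "Q (real n * x / c) / C - Q 0 / C = (Q (real n * x / c) - Q 0) / C"
        by (simp add: diff_divide_distrib)
      moreover have "lommel_tail_term \<nu> (- \<rho>) k * lommel_G_tilde (\<nu> + real k) \<nu> (- (real n * x / c)) - lommel_tail_term \<nu> (- \<rho>) k
          = sgn x ^ (k + 1) * ((2 * \<rho>) ^ k / fact k) * Gamma ((real k + 1) / 2) * Gamma ((real n + real k) / 2) *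
            lommel_G (\<nu> + real k) \<nu> (real n * \<bar>x\<bar> / c)" for k
      proof -
        have "(2 * - \<rho>) ^ k = (- 1) ^ k * (2 * \<rho>) ^ k" by (simp add: power_minus[of "2 * \<rho>"])
        moreover have "- (real n * x / c) = real n * \<bar>x\<bar> / c" using 3 by simp
        ultimately show ?thesis
          unfolding t_eq lommel_G_tilde_def using 3 by (simp add: right_diff_distrib)
      qed
      ultimately show ?thesis by simp
    qed
  qed

  show ?thesis
    unfolding \<nu>_def[symmetric] c_def[symmetric] C_def[symmetric]
  proof (intro conjI allI impI)
    fix x :: real assume "0 \<le> x"
    then have "0 \<le> real n * x / c" using c by simp
    note sums = upper[OF this, unfolded t_eq]
    show "summable (\<lambda>k. (2 * \<rho>) ^ k / fact k * Gamma ((real k + 1) / 2) * Gamma ((real n + real k) / 2) *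
        lommel_G_tilde (\<nu> + real k) \<nu> (real n * x / c))"
      by (rule sums_summable[OF sums])
    show "cdf (distr N borel (sample_mean n Z)) x = 1 - C *
        (\<Sum>k. (2 * \<rho>) ^ k / fact k * Gamma ((real k + 1) / 2) * Gamma ((real n + real k) / 2) *
           lommel_G_tilde (\<nu> + real k) \<nu> (real n * x / c))"
      unfolding cdf_eq sums_unique[OF sums, symmetric] using C by simp
  next
    fix x :: real assume "x < 0"
    then have "real n * x / c \<le> 0" using n c by (simp add: mult_nonneg_nonpos divide_nonpos_pos)
    note sums = lower[OF this, unfolded t_eq mult_minus_right mult_minus_left[symmetric]]
    show "summable (\<lambda>k. (- 2 * \<rho>) ^ k / fact k * Gamma ((real k + 1) / 2) * Gamma ((real n + real k) / 2) *
        lommel_G_tilde (\<nu> + real k) \<nu> (- (real n * x / c)))"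
      by (rule sums_summable[OF sums])
    show "cdf (distr N borel (sample_mean n Z)) x = C *
        (\<Sum>k. (- 2 * \<rho>) ^ k / fact k * Gamma ((real k + 1) / 2) * Gamma ((real n + real k) / 2) *
           lommel_G_tilde (\<nu> + real k) \<nu> (- (real n * x / c)))"
      unfolding cdf_eq sums_unique[OF sums, symmetric] using C by simp
  next
    fix x :: real
    show "summable (\<lambda>k. sgn x ^ (k + 1) * ((2 * \<rho>) ^ k / fact k) * Gamma ((real k + 1) / 2) * Gamma ((real n + real k) / 2) *
        lommel_G (\<nu> + real k) \<nu> (real n * \<bar>x\<bar> / c))"
      by (rule sums_summable[OF signed])
    show "cdf (distr N borel (sample_mean n Z)) x = 1 / 2
        - Gamma ((real n + 1) / 2) / (sqrt pi * Gamma (real n / 2)) * \<rho> * (1 - \<rho>\<^sup>2) powr (real n / 2) *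
            hypergeo_2F1 1 ((real n + 1) / 2) (3 / 2) (\<rho>\<^sup>2)
        + C * (\<Sum>k. sgn x ^ (k + 1) * ((2 * \<rho>) ^ k / fact k) * Gamma ((real k + 1) / 2) * Gamma ((real n + real k) / 2) *
             lommel_G (\<nu> + real k) \<nu> (real n * \<bar>x\<bar> / c))"
      unfolding cdf_eq sums_unique[OF signed, symmetric] Q0[symmetric] using C by simp
  next
    show "measure N {\<omega> \<in> space N. sample_mean n Z \<omega> \<le> 0} = 1 / 2
        - Gamma ((real n + 1) / 2) / (sqrt pi * Gamma (real n / 2)) * \<rho> * (1 - \<rho>\<^sup>2) powr (real n / 2) *
            hypergeo_2F1 1 ((real n + 1) / 2) (3 / 2) (\<rho>\<^sup>2)"
      unfolding mean_le Q0[symmetric] Q_def by simp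
  qed
qed

end
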